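(* Let $G$ be an abelian group. Then the following are equivalent: (1) $G$ has a connected Cayley graph that is not CCA. (2) $G$ has a connected Cayley graph that is not strongly CCA. (3) $G$ has a subgroup $H$ such that either $G \cong H \oplus \mathbb{Z}_4 \oplus \mathbb{Z}_2$, or $G \cong H \oplus \mathbb{Z}_2 \oplus \mathbb{Z}_2$ and $H$ has an element of order $4$. (4) $G$ has a subgroup $H$ such that either $G \cong H \oplus \mathbb{Z}_4 \oplus \mathbb{Z}_2$, or $G \cong H \oplus \mathbb{Z}_2 \oplus \mathbb{Z}_2$ and $H$ has an element of order $8$.
   Context: Groups are abelian, written additively, and may be infinite; $\mathbb{Z}_n$ is the cyclic group of order $n$. A Cayley graph of $G$ is a graph $\operatorname{Cay}(G;S)$, where $S$ is a subset of $G$ with $S = -S$ ($S$ is not required to be finite): it is the undirected graph whose vertices are the elements of $G$, with an edge joining $g$ and $g+s$ for all $g \in G$ and $s \in S$. (It is connected if and only if $S$ generates $G$.) An automorphism $\varphi$ of $\operatorname{Cay}(G;S)$ is colour-preserving if $\varphi(g+s) \in \{\varphi(g) \pm s\}$ for all $g \in G$ and $s \in S$. An automorphism $\varphi$ of $\operatorname{Cay}(G;S)$ is colour-permuting if there is a bijection $\pi \colon S \to S$ such that $\varphi(g+s) \in \{\varphi(g) \pm \pi(s)\}$ for all $g \in G$ and $s \in S$. A bijection $\varphi \colon G \to G$ is affine if there are a group automorphism $\tau$ of $G$ and an element $b \in G$ such that $\varphi(x) = \tau(x) + b$ for all $x \in G$. The graph $\operatorname{Cay}(G;S)$ is CCA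 if every colour-preserving automorphism of it is affine, and strongly CCA if every colour-permuting automorphism of it is affine. *)

theory Defs
  imports "HOL-Algebra.Elementary_Groups" "HOL-Algebra.Multiplicative_Group"
begin

text \<open>Abelian groups are \<^locale>\<open>comm_group\<close>s, written multiplicatively as in HOL-Algebra:
  \<open>g + s\<close>, \<open>- s\<close> and \<open>- S\<close> become \<open>g \<otimes> s\<close>, \<open>inv s\<close> and \<open>m_inv G ` S\<close>.\<close>

definition connection_set :: "('a, 'b) monoid_scheme \<Rightarrow> 'a set \<Rightarrow> bool" where
  "connection_set G S \<longleftrightarrow> S \<subseteq> carrier G \<and> m_inv G ` S = S"

text \<open>Undirected edges are sets of endpoints. The identity may lie in \<open>S\<close>; it contributes
  the loops \<open>{g}\<close>.\<close>

definition cayley_edges :: "('a, 'b) monoid_scheme \<Rightarrow> 'a set \<Rightarrow> 'a set set" where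
  "cayley_edges G S = {{g, g \<otimes>\<^bsub>G\<^esub> s} | g s. g \<in> carrier G \<and> s \<in> S}"

definition cayley_connected :: "('a, 'b) monoid_scheme \<Rightarrow> 'a set \<Rightarrow> bool" where
  "cayley_connected G S \<longleftrightarrow>
    (\<forall>x\<in>carrier G. \<forall>y\<in>carrier G. (x, y) \<in> {(u, v). {u, v} \<in> cayley_edges G S}\<^sup>*)"

text \<open>Maps on vertices are HOL functions of which only the values on \<open>carrier G\<close> matter.\<close>

definition cayley_automorphism :: "('a, 'b) monoid_scheme \<Rightarrow> 'a set \<Rightarrow> ('a \<Rightarrow> 'a) \<Rightarrow> bool" where
  "cayley_automorphism G S \<phi> \<longleftrightarrow>
    bij_betw \<phi> (carrier G) (carrier G) \<and>
    (\<forall>x\<in>carrier G. \<forall>y\<in>carrier G.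
      {x, y} \<in> cayley_edges G S \<longleftrightarrow> {\<phi> x, \<phi> y} \<in> cayley_edges G S)"

definition colour_preserving :: "('a, 'b) monoid_scheme \<Rightarrow> 'a set \<Rightarrow> ('a \<Rightarrow> 'a) \<Rightarrow> bool" where
  "colour_preserving G S \<phi> \<longleftrightarrow>
    (\<forall>g\<in>carrier G. \<forall>s\<in>S. \<phi> (g \<otimes>\<^bsub>G\<^esub> s) \<in> {\<phi> g \<otimes>\<^bsub>G\<^esub> s, \<phi> g \<otimes>\<^bsub>G\<^esub> inv\<^bsub>G\<^esub> s})"

definition colour_permuting :: "('a, 'b) monoid_scheme \<Rightarrow> 'a set \<Rightarrow> ('a \<Rightarrow> 'a) \<Rightarrow> bool" where
  "colour_permuting G S \<phi> \<longleftrightarrow>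
    (\<exists>\<pi>. bij_betw \<pi> S S \<and>
      (\<forall>g\<in>carrier G. \<forall>s\<in>S.
        \<phi> (g \<otimes>\<^bsub>G\<^esub> s) \<in> {\<phi> g \<otimes>\<^bsub>G\<^esub> \<pi> s, \<phi> g \<otimes>\<^bsub>G\<^esub> inv\<^bsub>G\<^esub> (\<pi> s)}))"

definition affine_bijection :: "('a, 'b) monoid_scheme \<Rightarrow> ('a \<Rightarrow> 'a) \<Rightarrow> bool" where
  "affine_bijection G \<phi> \<longleftrightarrow>
    bij_betw \<phi> (carrier G) (carrier G) \<and>
    (\<exists>\<tau>\<in>iso G G. \<exists>b\<in>carrier G. \<forall>x\<in>carrier G. \<phi> x = \<tau> x \<otimes>\<^bsub>G\<^esub> b)"

definition CCA :: "('a, 'b) monoid_scheme \<Rightarrow> 'a set \<Rightarrow> bool" where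
  "CCA G S \<longleftrightarrow>
    (\<forall>\<phi>. cayley_automorphism G S \<phi> \<and> colour_preserving G S \<phi> \<longrightarrow> affine_bijection G \<phi>)"

definition strongly_CCA :: "('a, 'b) monoid_scheme \<Rightarrow> 'a set \<Rightarrow> bool" where
  "strongly_CCA G S \<longleftrightarrow>
    (\<forall>\<phi>. cayley_automorphism G S \<phi> \<and> colour_permuting G S \<phi> \<longrightarrow> affine_bijection G \<phi>)"

end

theory Submission
  imports Defs
begin

text \<open>In additive notation, all four conditions are equivalent to the existence of \<open>a\<close> of order 4 and
  \<open>b\<close> of order 2 such that none of \<open>a\<close>, \<open>b\<close>, \<open>a + b\<close> lies in \<open>2G\<close>.

  Given such \<open>a\<close> and \<open>b\<close>, take a subgroup \<open>L \<supseteq> 2G\<close> maximal among those avoiding \<open>a\<close>, \<open>b\<close> and \<open>a + b\<close>;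
  it has index 4. The graph with \<open>S = L \<union> {\<plusminus>a, \<plusminus>(a + b)}\<close> is not CCA, because translating the coset
  \<open>a + L\<close> by \<open>2a\<close> and fixing everything else preserves colours: \<open>2s = 2a = -2a\<close> for the elements
  \<open>s\<close> of \<open>S\<close> outside \<open>L\<close>. If \<open>2a = 4y\<close> for some \<open>y \<in> L\<close>, then
  \<open>G = L \<oplus> \<langle>a - 2y\<rangle> \<oplus> \<langle>b\<rangle>\<close>, and \<open>y\<close> has order 8; otherwise a subgroup of \<open>L + \<langle>a\<rangle>\<close>
  maximal with respect to containing \<open>4G\<close> and avoiding \<open>2a\<close> is a complement of \<open>\<langle>a\<rangle> \<oplus> \<langle>b\<rangle>\<close>.

  Conversely, let \<open>\<phi>\<close> be colour-permuting and write \<open>\<phi>(g + s) = \<phi>(g) + \<epsilon>\<^sub>s(g) \<pi>(s)\<close> with signs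
  \<open>\<epsilon>\<^sub>s(g)\<close>. If \<open>\<phi>\<close> is not affine, some \<open>\<epsilon>\<^sub>s\<close> with \<open>2\<pi>(s) \<noteq> 0\<close> is not constant. Comparing the two paths
  from \<open>g\<close> to \<open>g + s + u\<close> shows that \<open>\<epsilon>\<^sub>s\<close> can only change along colours \<open>u\<close> with
  \<open>2\<pi>(u) = \<plusminus>2\<pi>(s)\<close>, and that then \<open>\<epsilon>\<^sub>u\<close> changes along \<open>s\<close>. It follows that \<open>2G\<close> consists of
  periods of \<open>\<epsilon>\<^sub>s\<close>, so that elements along which \<open>\<epsilon>\<^sub>s\<close> changes are outside \<open>2G\<close>.\<close>

section \<open>Elements of order four and two outside the squares\<close>

definition squares :: "('a, 'b) monoid_scheme \<Rightarrow> 'a set" where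
  "squares G = (\<lambda>x. x \<otimes>\<^bsub>G\<^esub> x) ` carrier G"

text \<open>The identity is a square, so \<open>b\<close> has order exactly 2. Modulo the subgroup
  of squares, the last three conditions say that \<open>a\<close> and \<open>b\<close> are linearly
  independent over the field with two elements.\<close>

definition nonsquare_four_two :: "('a, 'b) monoid_scheme \<Rightarrow> bool" where
  "nonsquare_four_two G \<longleftrightarrow>
    (\<exists>a\<in>carrier G. \<exists>b\<in>carrier G.
      a \<otimes>\<^bsub>G\<^esub> a \<noteq> \<one>\<^bsub>G\<^esub> \<and> (a \<otimes>\<^bsub>G\<^esub> a) \<otimes>\<^bsub>G\<^esub> (a \<otimes>\<^bsub>G\<^esub> a) = \<one>\<^bsub>G\<^esub> \<and> b \<otimes>\<^bsub>G\<^esub> b = \<one>\<^bsub>G\<^esub> \<and>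
      a \<notin> squares G \<and> b \<notin> squares G \<and> a \<otimes>\<^bsub>G\<^esub> b \<notin> squares G)"

section \<open>Invariance under isomorphism, and the two model groups\<close>

lemma (in group) iso_image_squares:
  assumes f: "f \<in> iso G K" and x: "x \<in> carrier G" and K: "group K"
  shows "f x \<in> squares K \<longleftrightarrow> x \<in> squares G"
proof -
  interpret f: group_hom G K f
    using f K by (simp add: group_hom_def group_hom_axioms_def iso_imp_homomorphism)
  have inj: "inj_on f (carrier G)" and im: "f ` carrier G = carrier K"
    using f by (auto simp: iso_iff)
  show ?thesis
  proof
    assume "f x \<in> squares K"
    then obtain y where y: "y \<in> carrier K" "f x = y \<otimes>\<^bsub>K\<^esub> y"
      by (auto simp: squares_def)
    then obtain z where z: "z \<in> carrier G" "y = f z"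
      using im by blast
    then have "f x = f (z \<otimes> z)"
      using y by simp
    then have "x = z \<otimes> z"
      using inj x z by (meson inj_onD m_closed)
    then show "x \<in> squares G"
      using z by (auto simp: squares_def)
  next
    assume "x \<in> squares G"
    then show "f x \<in> squares K"
      by (auto simp: squares_def)
  qed
qed

lemma (in group) nonsquare_four_two_iso:
  assumes iso: "G \<cong> K" and K: "group K" and st: "nonsquare_four_two G"
  shows "nonsquare_four_two K"
proof -
  obtain f where f: "f \<in> iso G K"
    using iso by (auto simp: is_iso_def)
  interpret f: group_hom G K f
    using f K by (simp add: group_hom_def group_hom_axioms_def iso_imp_homomorphism)
  have inj: "inj_on f (carrier G)"
    using f by (auto simp: iso_iff)
  obtain a b where ab: "a \<in> carrier G" "b \<in> carrier G"
      and "a \<otimes> a \<noteq> \<one>" "(a \<otimes> a) \<otimes> (a \<otimes> a) = \<one>" "b \<otimes> b = \<one>"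
      and nsq: "a \<notin> squares G" "b \<notin> squares G" "a \<otimes> b \<notin> squares G"
    using st by (auto simp: nonsquare_four_two_def)
  then have "f (a \<otimes> a) \<noteq> f \<one>" "f ((a \<otimes> a) \<otimes> (a \<otimes> a)) = f \<one>" "f (b \<otimes> b) = f \<one>"
    using ab by (simp_all add: inj_on_eq_iff[OF inj] del: f.hom_mult f.hom_one)
  moreover have "f a \<notin> squares K" "f b \<notin> squares K" "f (a \<otimes> b) \<notin> squares K"
    using ab nsq by (simp_all add: iso_image_squares[OF f _ K] del: f.hom_mult)
  ultimately show ?thesis
    unfolding nonsquare_four_two_def using ab
    by (intro bexI[of _ "f a"] bexI[of _ "f b"]) simp_all
qed

text \<open>Doubling modulo 4 or 2 gives an even residue, so a coordinate 1 excludes a square; the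
  generators of the cyclic factors are the witnesses.\<close>

lemma (in group) nonsquare_four_two_DirProd_4_2:
  "nonsquare_four_two (G \<times>\<times> (integer_mod_group 4 \<times>\<times> integer_mod_group 2))"
proof -
  have "(2 * i) mod 4 \<noteq> (1::int)" "(2 * i) mod 2 \<noteq> (1::int)" for i
    by presburger+
  then show ?thesis
    unfolding nonsquare_four_two_def
    by (intro bexI[of _ "(\<one>, (1, 0))"] bexI[of _ "(\<one>, (0, 1))"])
       (auto simp: squares_def carrier_integer_mod_group simp flip: mult_2)
qed

text \<open>Here \<open>h\<close> gives the first witness its order 4, and the coordinate 1 keeps it
  from being a square.\<close>

lemma (in group) nonsquare_four_two_DirProd_2_2:
  assumes h: "h \<in> carrier G" "h \<otimes> h \<noteq> \<one>" "(h \<otimes> h) \<otimes> (h \<otimes> h) = \<one>"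
  shows "nonsquare_four_two (G \<times>\<times> (integer_mod_group 2 \<times>\<times> integer_mod_group 2))"
proof -
  have "(2 * i) mod 2 \<noteq> (1::int)" for i
    by presburger
  then show ?thesis
    unfolding nonsquare_four_two_def using h
    by (intro bexI[of _ "(h, (1, 0))"] bexI[of _ "(\<one>, (0, 1))"])
       (auto simp: squares_def carrier_integer_mod_group simp flip: mult_2)
qed

section \<open>Maximal subgroups avoiding a set, and the complements they give\<close>

lemma (in comm_group) subgroup_image_square:
  assumes "subgroup N G"
  shows "subgroup ((\<lambda>x. x \<otimes> x) ` N) G"
proof -
  interpret N: subgroup N G by fact
  show ?thesis
  proof
    show "(\<lambda>x. x \<otimes> x) ` N \<subseteq> carrier G"
      by auto
    show "\<one> \<in> (\<lambda>x. x \<otimes> x) ` N"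
      by (rule image_eqI[of _ _ \<one>]) simp_all
  next
    fix x y assume "x \<in> (\<lambda>x. x \<otimes> x) ` N" "y \<in> (\<lambda>x. x \<otimes> x) ` N"
    then obtain u v where uv: "u \<in> N" "v \<in> N" "x = u \<otimes> u" "y = v \<otimes> v"
      by auto
    then have "x \<otimes> y = (u \<otimes> v) \<otimes> (u \<otimes> v)"
      by (simp add: m_ac)
    then show "x \<otimes> y \<in> (\<lambda>x. x \<otimes> x) ` N"
      using uv by blast
  next
    fix x assume "x \<in> (\<lambda>x. x \<otimes> x) ` N"
    then obtain u where u: "u \<in> N" "x = u \<otimes> u"
      by auto
    then have "inv x = inv u \<otimes> inv u"
      by (simp add: inv_mult)
    then show "inv x \<in> (\<lambda>x. x \<otimes> x) ` N"
      using u by blast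
  qed
qed

lemma (in comm_group) subgroup_squares: "subgroup (squares G) G"
  unfolding squares_def by (intro subgroup_image_square subgroup_self)

lemma (in comm_group) subgroup_Un_coset:
  assumes N: "subgroup N G" and x: "x \<in> carrier G" "x \<otimes> x \<in> N"
  shows "subgroup (N \<union> (\<lambda>n. n \<otimes> x) ` N) G"
proof -
  interpret N: subgroup N G by fact
  have inv: "inv (n \<otimes> x) = (inv n \<otimes> inv (x \<otimes> x)) \<otimes> x" if "n \<in> N" for n
    using that x by (simp add: inv_mult m_assoc)
  have mult: "(n \<otimes> x) \<otimes> (n' \<otimes> x) = (n \<otimes> n') \<otimes> (x \<otimes> x)"
      "n \<otimes> (n' \<otimes> x) = (n \<otimes> n') \<otimes> x" "(n \<otimes> x) \<otimes> n' = (n \<otimes> n') \<otimes> x"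
    if "n \<in> N" "n' \<in> N" for n n'
    using that x by (simp_all add: m_ac)
  show ?thesis
  proof
    show "N \<union> (\<lambda>n. n \<otimes> x) ` N \<subseteq> carrier G"
      using x by auto
    show "y \<otimes> z \<in> N \<union> (\<lambda>n. n \<otimes> x) ` N"
      if "y \<in> N \<union> (\<lambda>n. n \<otimes> x) ` N" "z \<in> N \<union> (\<lambda>n. n \<otimes> x) ` N" for y z
      using that x by (auto simp: mult)
    show "inv y \<in> N \<union> (\<lambda>n. n \<otimes> x) ` N" if "y \<in> N \<union> (\<lambda>n. n \<otimes> x) ` N" for y
      using that x by (auto simp: inv)
  qed auto
qed

text \<open>Zorn's lemma, with unions of chains as upper bounds. If x^2 lies in a maximal
  \<open>N\<close> but x does not, then \<open>N\<close> and N x together form a larger subgroup, so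
  some z = n x is in \<open>X\<close>; then z x = n x^2 is back in \<open>N\<close>.\<close>

lemma (in comm_group) maximal_subgroup_avoiding:
  assumes N0: "subgroup N0 G" "N0 \<inter> X = {}"
  obtains N where "subgroup N G" "N0 \<subseteq> N" "N \<inter> X = {}"
    "\<And>x. x \<in> carrier G \<Longrightarrow> x \<otimes> x \<in> N \<Longrightarrow> x \<in> N \<or> (\<exists>z\<in>X. z \<otimes> x \<in> N)"
proof -
  define A where "A = {N. subgroup N G \<and> N0 \<subseteq> N \<and> N \<inter> X = {}}"
  have "\<exists>M\<in>A. \<forall>N\<in>A. M \<subseteq> N \<longrightarrow> N = M"
  proof (rule subset_Zorn_nonempty)
    show "A \<noteq> {}"
      using N0 by (auto simp: A_def)
    fix C assume C: "C \<noteq> {}" "subset.chain A C"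
    then have sub: "subgroup N G" "N0 \<subseteq> N" "N \<inter> X = {}" if "N \<in> C" for N
      using that by (auto simp: A_def subset_chain_def)
    have "subgroup (\<Union>C) G"
    proof
      show "\<Union>C \<subseteq> carrier G"
        using sub(1) by (auto dest: subgroup.subset)
      show "\<one> \<in> \<Union>C"
        using C(1) subgroup.one_closed[OF sub(1)] by blast
      show "inv x \<in> \<Union>C" if "x \<in> \<Union>C" for x
        using that subgroup.m_inv_closed[OF sub(1)] by blast
      fix x y assume "x \<in> \<Union>C" "y \<in> \<Union>C"
      then obtain M N where MN: "M \<in> C" "N \<in> C" "x \<in> M" "y \<in> N"
        by blast
      then have "M \<subseteq> N \<or> N \<subseteq> M"
        using C(2) by (auto simp: subset_chain_def)
      then obtain K where "K \<in> C" "x \<in> K" "y \<in> K"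
        using MN by blast
      then show "x \<otimes> y \<in> \<Union>C"
        using subgroup.m_closed[OF sub(1)] by blast
    qed
    moreover have "N0 \<subseteq> \<Union>C" "\<Union>C \<inter> X = {}"
      using C(1) sub(2,3) by blast+
    ultimately show "\<Union>C \<in> A"
      by (simp add: A_def)
  qed
  then obtain N where "N \<in> A" and N_max: "\<forall>M\<in>A. N \<subseteq> M \<longrightarrow> M = N"
    by blast
  then have N: "subgroup N G" "N0 \<subseteq> N" "N \<inter> X = {}"
    by (simp_all add: A_def)
  have max: "M = N" if "subgroup M G" "N \<subseteq> M" "M \<inter> X = {}" for M
    using that N(2) N_max by (auto simp: A_def)
  interpret N: subgroup N G by fact
  have "x \<in> N \<or> (\<exists>z\<in>X. z \<otimes> x \<in> N)" if x: "x \<in> carrier G" "x \<otimes> x \<in> N" for x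
  proof (cases "(N \<union> (\<lambda>n. n \<otimes> x) ` N) \<inter> X = {}")
    case True
    have "x = \<one> \<otimes> x" using x by simp
    then have "x \<in> N \<union> (\<lambda>n. n \<otimes> x) ` N"
      using N.one_closed by blast
    then show ?thesis
      using max[OF subgroup_Un_coset[OF N(1) x]] True by blast
  next
    case False
    then obtain n where n: "n \<in> N" "n \<otimes> x \<in> X"
      using N(3) by blast
    have "(n \<otimes> x) \<otimes> x = n \<otimes> (x \<otimes> x)"
      using n x by (simp add: m_assoc)
    then show ?thesis
      using n x by (intro disjI2 bexI[of _ "n \<otimes> x"]) auto
  qed
  with N that show thesis by blast
qed

text \<open>The isomorphism from the product sends (h, i, j) to h u^i v^j; \<open>span\<close> makes
  it surjective and \<open>indep\<close> makes it injective.\<close>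

lemma (in comm_group) iso_DirProd_cyclic:
  assumes H: "subgroup H G" and u: "u \<in> carrier G" "u [^] m = \<one>" and v: "v \<in> carrier G" "v [^] n = \<one>"
    and pos: "0 < m" "0 < n"
    and span: "\<And>x. x \<in> carrier G \<Longrightarrow> \<exists>h\<in>H. \<exists>(i::int) (j::int). x = h \<otimes> (u [^] i \<otimes> v [^] j)"
    and indep: "\<And>(i::int) (j::int). \<lbrakk>0 \<le> i; i < m; 0 \<le> j; j < n; u [^] i \<otimes> v [^] j \<in> H\<rbrakk> \<Longrightarrow> i = 0 \<and> j = 0"
  shows "G \<cong> G\<lparr>carrier := H\<rparr> \<times>\<times> (integer_mod_group m \<times>\<times> integer_mod_group n)"
proof -
  interpret H: subgroup H G by fact
  let ?D = "G\<lparr>carrier := H\<rparr> \<times>\<times> (integer_mod_group m \<times>\<times> integer_mod_group n)"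
  define f where "f = (\<lambda>(h, i::int, j::int). h \<otimes> (u [^] i \<otimes> v [^] j))"
  have mod: "w [^] (i mod int k) = w [^] i" if "w \<in> carrier G" "w [^] k = \<one>" for w i k
  proof -
    have "int (ord w) dvd int k"
      using that by (simp add: pow_eq_id)
    then have "int (ord w) dvd i - i mod int k"
      by (meson dvd_trans dvd_minus_mod)
    then show ?thesis
      using that by (simp add: int_pow_eq)
  qed
  have D: "group ?D"
    by (intro DirProd_group group_integer_mod_group H.subgroup_is_group is_group)
  have f: "f \<in> hom ?D G"
  proof (rule homI)
    show "f x \<in> carrier G" if "x \<in> carrier ?D" for x
      using that u v by (auto simp: f_def)
    show "f (x \<otimes>\<^bsub>?D\<^esub> y) = f x \<otimes> f y" if "x \<in> carrier ?D" "y \<in> carrier ?D" for x y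
      using that u v by (auto simp: f_def mod int_pow_mult m_ac)
  qed
  interpret f: group_hom ?D G f
    using D f by (simp add: group_hom_def group_hom_axioms_def)
  have "inj_on f (carrier ?D)"
    unfolding f.inj_on_one_iff
  proof (intro allI impI)
    fix x assume "x \<in> carrier ?D" "f x = \<one>"
    then obtain h i j where x: "x = (h, i, j)" "h \<in> H" "0 \<le> i" "i < m" "0 \<le> j" "j < n"
        and eq: "h \<otimes> (u [^] i \<otimes> v [^] j) = \<one>"
      using pos by (auto simp: f_def carrier_integer_mod_group)
    have "u [^] i \<otimes> v [^] j = inv h"
      using eq x u v by (metis H.mem_carrier int_pow_closed inv_equality inv_inv m_closed)
    then have "i = 0 \<and> j = 0"
      using indep x by simp
    then show "x = \<one>\<^bsub>?D\<^esub>"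
      using x eq by simp
  qed
  moreover have "x \<in> f ` carrier ?D" if x: "x \<in> carrier G" for x
  proof -
    obtain h and i j :: int where h: "h \<in> H" "x = h \<otimes> (u [^] i \<otimes> v [^] j)"
      using span[OF x] by blast
    then have "x = f (h, i mod int m, j mod int n)"
      using u v by (simp add: f_def mod)
    then show ?thesis
      using h pos by (intro image_eqI[of _ _ "(h, i mod int m, j mod int n)"])
        (simp_all add: carrier_integer_mod_group)
  qed
  ultimately have "f \<in> iso ?D G"
    using f by (auto simp: iso_iff)
  then show ?thesis
    using D group.iso_sym is_isoI by blast
qed

text \<open>Turns membership of u^i v^j x in a subgroup into the factorisation asked for by
  \<open>span\<close> in \<open>iso_DirProd_cyclic\<close>.\<close>

lemma (in comm_group) eq_mult_int_pow_neg:
  assumes "u \<in> carrier G" "v \<in> carrier G" "x \<in> carrier G"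
  shows "x = (u [^] (i::int) \<otimes> v [^] (j::int) \<otimes> x) \<otimes> (u [^] (-i) \<otimes> v [^] (-j))"
proof -
  have "(u [^] i \<otimes> v [^] j \<otimes> x) \<otimes> (u [^] (-i) \<otimes> v [^] (-j))
      = (u [^] i \<otimes> inv (u [^] i)) \<otimes> (v [^] j \<otimes> inv (v [^] j)) \<otimes> x"
    using assms by (simp add: int_pow_neg m_ac del: r_inv)
  then show ?thesis
    using assms by simp
qed

text \<open>All squares are in \<open>L\<close>, so \<open>maximal_subgroup_avoiding\<close> applies
  to every x. The cosets of \<open>L\<close> are therefore those of 1, a, b and a b.\<close>

lemma (in comm_group) index_four_subgroup:
  assumes ab: "a \<in> carrier G" "b \<in> carrier G"
    and "a \<notin> squares G" "b \<notin> squares G" "a \<otimes> b \<notin> squares G"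
  obtains L where "subgroup L G" "squares G \<subseteq> L" "a \<notin> L" "b \<notin> L" "a \<otimes> b \<notin> L"
    "\<And>x. x \<in> carrier G \<Longrightarrow> x \<in> L \<or> a \<otimes> x \<in> L \<or> b \<otimes> x \<in> L \<or> a \<otimes> b \<otimes> x \<in> L"
proof -
  have "squares G \<inter> {a, b, a \<otimes> b} = {}"
    using assms by blast
  then obtain L where L: "subgroup L G" "squares G \<subseteq> L" "L \<inter> {a, b, a \<otimes> b} = {}"
      and max: "\<And>x. x \<in> carrier G \<Longrightarrow> x \<otimes> x \<in> L \<Longrightarrow> x \<in> L \<or> (\<exists>z\<in>{a, b, a \<otimes> b}. z \<otimes> x \<in> L)"
    using maximal_subgroup_avoiding[OF subgroup_squares] by metis
  have "x \<in> L \<or> a \<otimes> x \<in> L \<or> b \<otimes> x \<in> L \<or> a \<otimes> b \<otimes> x \<in> L" if "x \<in> carrier G" for x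
  proof -
    have "x \<otimes> x \<in> L"
      using that L(2) by (auto simp: squares_def)
    then show ?thesis
      using max[OF that] by blast
  qed
  then show thesis
    using that L by blast
qed

lemma (in comm_group) summand_of_nonsquare_four_two:
  assumes "nonsquare_four_two G"
  shows "\<exists>H. subgroup H G \<and>
    (G \<cong> G\<lparr>carrier := H\<rparr> \<times>\<times> (integer_mod_group 4 \<times>\<times> integer_mod_group 2) \<or>
     G \<cong> G\<lparr>carrier := H\<rparr> \<times>\<times> (integer_mod_group 2 \<times>\<times> integer_mod_group 2) \<and>
       (\<exists>h\<in>H. ord h = 8))"
proof -
  obtain a b where ab: "a \<in> carrier G" "b \<in> carrier G"
      and a2: "a \<otimes> a \<noteq> \<one>" and a4: "(a \<otimes> a) \<otimes> (a \<otimes> a) = \<one>" and b2: "b \<otimes> b = \<one>"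
      and nsq: "a \<notin> squares G" "b \<notin> squares G" "a \<otimes> b \<notin> squares G"
    using assms by (auto simp: nonsquare_four_two_def)
  obtain L where L: "subgroup L G" "squares G \<subseteq> L" "a \<notin> L" "b \<notin> L" "a \<otimes> b \<notin> L"
    and cosets: "\<And>x. x \<in> carrier G \<Longrightarrow> x \<in> L \<or> a \<otimes> x \<in> L \<or> b \<otimes> x \<in> L \<or> a \<otimes> b \<otimes> x \<in> L"
    using index_four_subgroup[OF ab nsq] by blast
  interpret L: subgroup L G by fact
  have sq: "x \<otimes> x \<in> L" if "x \<in> carrier G" for x
    using that L(2) by (auto simp: squares_def)
  have cancelL: "x \<in> L" if "x \<otimes> y \<in> L" "x \<in> carrier G" "y \<in> L" for x y
  proof -
    have "x = (x \<otimes> y) \<otimes> inv y"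
      using that by (simp add: m_assoc)
    then show ?thesis
      using that by (metis L.m_closed L.m_inv_closed)
  qed
  have ap: "a [^] (2::int) = a \<otimes> a" "a [^] (3::int) = a \<otimes> a \<otimes> a" "a [^] (4::int) = \<one>"
    using ab a4 int_pow_mult[of a 1 1] int_pow_mult[of a 2 1] int_pow_mult[of a 2 2] by simp_all
  show ?thesis
  proof (cases "\<exists>y\<in>carrier G. (y \<otimes> y) \<otimes> (y \<otimes> y) = a \<otimes> a")
    case True
    then obtain y where y: "y \<in> carrier G" "(y \<otimes> y) \<otimes> (y \<otimes> y) = a \<otimes> a"
      by blast
    \<comment> \<open>Factors with trivial fourth power do not change y^4. Since 1, a, b and a b are
      such factors, one of them moves y into \<open>L\<close>.\<close>
    have shift: "((c \<otimes> y) \<otimes> (c \<otimes> y)) \<otimes> ((c \<otimes> y) \<otimes> (c \<otimes> y)) = a \<otimes> a"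
      if "c \<in> carrier G" "(c \<otimes> c) \<otimes> (c \<otimes> c) = \<one>" for c
    proof -
      have "((c \<otimes> y) \<otimes> (c \<otimes> y)) \<otimes> ((c \<otimes> y) \<otimes> (c \<otimes> y))
          = ((c \<otimes> c) \<otimes> (c \<otimes> c)) \<otimes> ((y \<otimes> y) \<otimes> (y \<otimes> y))"
        using that(1) y(1) by (simp add: m_ac)
      then show ?thesis
        using that y ab by simp
    qed
    have "((a \<otimes> b) \<otimes> (a \<otimes> b)) \<otimes> ((a \<otimes> b) \<otimes> (a \<otimes> b)) = ((a \<otimes> a) \<otimes> (a \<otimes> a)) \<otimes> ((b \<otimes> b) \<otimes> (b \<otimes> b))"
      using ab by (simp add: m_ac)
    then obtain z where z: "z \<in> L" "(z \<otimes> z) \<otimes> (z \<otimes> z) = a \<otimes> a"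
      using cosets[OF y(1)] shift[of \<one>] shift[of a] shift[of b] shift[of "a \<otimes> b"] y ab a4 b2
      by (metis l_one m_closed one_closed)
    \<comment> \<open>Correcting a by z^2, an element of \<open>L\<close>, gives an involution in
      the same coset: c^2 = a^2 z^-4 = 1.\<close>
    define c where "c = a \<otimes> inv (z \<otimes> z)"
    have c: "c \<in> carrier G" "c \<otimes> (z \<otimes> z) = a"
      using ab z by (simp_all add: c_def m_assoc)
    have "c \<otimes> c = (a \<otimes> a) \<otimes> inv ((z \<otimes> z) \<otimes> (z \<otimes> z))"
      using ab z(1) by (simp add: c_def inv_mult m_ac)
    then have c2: "c \<otimes> c = \<one>"
      using z ab by simp
    have cL: "c \<otimes> x \<in> L \<longleftrightarrow> a \<otimes> x \<in> L" if "x \<in> carrier G" for x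
    proof -
      have "a \<otimes> x = (c \<otimes> x) \<otimes> (z \<otimes> z)"
        using c that z(1) by (metis L.mem_carrier m_assoc m_closed m_comm)
      then show ?thesis
        using cancelL c(1) z(1) that by (metis L.m_closed m_closed)
    qed
    have "G \<cong> G\<lparr>carrier := L\<rparr> \<times>\<times> (integer_mod_group 2 \<times>\<times> integer_mod_group 2)"
    proof (rule iso_DirProd_cyclic[OF L(1) c(1) _ ab(2)])
      show "c [^] (2::nat) = \<one>" "b [^] (2::nat) = \<one>"
        using c c2 ab b2 by (simp_all add: numeral_2_eq_2)
    next
      fix x assume x: "x \<in> carrier G"
      have "\<exists>(i::int) (j::int). c [^] i \<otimes> b [^] j \<otimes> x \<in> L"
        using cosets[OF x] cL[OF x] cL[of "b \<otimes> x"] x ab c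
        by (elim disjE) (rule exI[of _ 0] exI[of _ 1], rule exI[of _ 0] exI[of _ 1], simp add: m_assoc)+
      then obtain i j :: int where "c [^] i \<otimes> b [^] j \<otimes> x \<in> L"
        by blast
      then show "\<exists>h\<in>L. \<exists>(i::int) (j::int). x = h \<otimes> (c [^] i \<otimes> b [^] j)"
        using eq_mult_int_pow_neg[OF c(1) ab(2) x] by blast
    next
      fix i j :: int
      assume "0 \<le> i" "i < int 2" "0 \<le> j" "j < int 2" and *: "c [^] i \<otimes> b [^] j \<in> L"
      then have "i = 0 \<or> i = 1" "j = 0 \<or> j = 1"
        by auto
      then show "i = 0 \<and> j = 0"
        using * cL[of b] cL[of \<one>] L c ab by auto
    qed simp_all
    moreover have "ord z = 8"
    proof -
      have "z [^] (4::nat) = a \<otimes> a"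
        using z by (simp add: numeral_eq_Suc m_assoc)
      moreover have "z [^] (8::nat) = z [^] (4::nat) \<otimes> z [^] (4::nat)"
        using z by (simp add: nat_pow_mult)
      ultimately have "ord z dvd 8" "\<not> ord z dvd 4"
        using z a2 a4 pow_eq_id[of z 8] pow_eq_id[of z 4] by auto
      moreover from this have "ord z \<le> 8"
        by (simp add: dvd_imp_le)
      then have "ord z \<in> {0, 1, 2, 3, 4, 5, 6, 7, 8}"
        by auto
      ultimately show ?thesis
        by auto
    qed
    ultimately show ?thesis
      using L z by blast
  next
    case False
    \<comment> \<open>\<open>K\<close> has index 2 and contains a but not b. As b supplies the
      factor of order 2, it remains to find a complement in \<open>K\<close> of the subgroup
      generated by a.\<close>
    define K where "K = L \<union> (\<lambda>n. n \<otimes> a) ` L"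
    have K: "subgroup K G"
      unfolding K_def by (rule subgroup_Un_coset[OF L(1) ab(1) sq[OF ab(1)]])
    interpret K: subgroup K G by fact
    have aK: "a \<in> K"
      unfolding K_def using ab by (intro UnI2 image_eqI[of _ _ \<one>]) simp_all
    have bK: "b \<notin> K"
    proof
      assume "b \<in> K"
      then obtain l where "l \<in> L" "b = l \<otimes> a"
        using L(4) by (auto simp: K_def)
      then have "a \<otimes> b = l \<otimes> (a \<otimes> a)"
        using ab by (simp add: m_ac)
      then show False
        using \<open>l \<in> L\<close> sq[OF ab(1)] L(5) by simp
    qed
    have cosetsK: "x \<in> K \<or> b \<otimes> x \<in> K" if x: "x \<in> carrier G" for x
    proof -
      have *: "w \<in> K" if "a \<otimes> w \<in> L" "w \<in> carrier G" for w
      proof -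
        have "w = inv a \<otimes> (a \<otimes> w)"
          using that ab by (simp flip: m_assoc)
        moreover have "a \<otimes> w \<in> K"
          using that by (simp add: K_def)
        ultimately show ?thesis
          using aK by (metis K.m_closed K.m_inv_closed)
      qed
      show ?thesis
        using cosets[OF x] *[OF _ x] *[of "b \<otimes> x"] x ab by (auto simp: K_def m_assoc)
    qed
    \<comment> \<open>These are the fourth powers, and a^2 is not among them in this case. Avoiding
      everything outside \<open>K\<close> as well keeps \<open>M\<close> inside
      \<open>K\<close>.\<close>
    let ?Q = "(\<lambda>x. x \<otimes> x) ` squares G"
    have disj: "?Q \<inter> ({a \<otimes> a} \<union> (carrier G - K)) = {}"
      using False sq by (auto simp: squares_def K_def)
    obtain M where M: "subgroup M G" "?Q \<subseteq> M" "M \<inter> ({a \<otimes> a} \<union> (carrier G - K)) = {}"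
      and max: "\<And>x. x \<in> carrier G \<Longrightarrow> x \<otimes> x \<in> M \<Longrightarrow>
        x \<in> M \<or> (\<exists>z\<in>{a \<otimes> a} \<union> (carrier G - K). z \<otimes> x \<in> M)"
      using maximal_subgroup_avoiding[OF subgroup_image_square[OF subgroup_squares] disj] by blast
    interpret M: subgroup M G by fact
    have MK: "M \<subseteq> K"
      using M(3) M.subset by blast
    have a2M: "a \<otimes> a \<notin> M"
      using M(3) by blast
    \<comment> \<open>For x in \<open>K\<close>, an element z with z x in \<open>M\<close> lies in
      \<open>K\<close>, so a^2 is the only possible obstruction.\<close>
    have step: "x \<in> M \<or> a \<otimes> a \<otimes> x \<in> M" if x: "x \<in> K" "x \<otimes> x \<in> M" for x
    proof (rule ccontr)
      assume "\<not> ?thesis"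
      then obtain z where z: "z \<in> carrier G - K" "z \<otimes> x \<in> M"
        using max[of x] x K.subset by blast
      have "z = (z \<otimes> x) \<otimes> inv x"
        using z x by (simp add: m_assoc)
      then show False
        using z x MK by (metis DiffD2 K.m_closed K.m_inv_closed subsetD)
    qed
    have cosetsM: "x \<in> M \<or> a \<otimes> a \<otimes> x \<in> M \<or> a \<otimes> x \<in> M \<or> a \<otimes> a \<otimes> a \<otimes> x \<in> M" if x: "x \<in> K" for x
    proof -
      \<comment> \<open>The square root is taken twice: from x^4 in \<open>M\<close> to x^2 or (a
        x)^2 in \<open>M\<close>, and from there by \<open>step\<close> for x or for a x.\<close>
      have "(x \<otimes> x) \<otimes> (x \<otimes> x) \<in> M"
        using M(2) x K.subset by (auto simp: squares_def)
      then have "x \<otimes> x \<in> M \<or> a \<otimes> a \<otimes> (x \<otimes> x) \<in> M"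
        using step[of "x \<otimes> x"] x by simp
      moreover have "a \<otimes> a \<otimes> (x \<otimes> x) = (a \<otimes> x) \<otimes> (a \<otimes> x)"
        using x ab by (simp add: m_ac)
      ultimately show ?thesis
        using step[of x] step[of "a \<otimes> x"] x aK ab by (auto simp: m_assoc)
    qed
    have "G \<cong> G\<lparr>carrier := M\<rparr> \<times>\<times> (integer_mod_group 4 \<times>\<times> integer_mod_group 2)"
    proof (rule iso_DirProd_cyclic[OF M(1) ab(1) _ ab(2)])
      show "a [^] (4::nat) = \<one>"
        using ap(3) by (metis int_pow_int of_nat_numeral)
      show "b [^] (2::nat) = \<one>"
        using ab b2 by (simp_all add: numeral_2_eq_2)
    next
      fix x assume x: "x \<in> carrier G"
      have *: "\<exists>i::int. a [^] i \<otimes> w \<in> M" if "w \<in> K" for w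
        using cosetsM[OF that] that ab ap(1,2) by (metis int_pow_0 int_pow_1 K.mem_carrier l_one)
      obtain j :: int where j: "b [^] j \<otimes> x \<in> K"
        using cosetsK[OF x] x ab by (metis int_pow_0 int_pow_1 l_one)
      then obtain i :: int where i: "a [^] i \<otimes> (b [^] j \<otimes> x) \<in> M"
        using * by blast
      then have "a [^] i \<otimes> b [^] j \<otimes> x \<in> M"
        using x ab by (simp add: m_assoc)
      then show "\<exists>h\<in>M. \<exists>(i::int) (j::int). x = h \<otimes> (a [^] i \<otimes> b [^] j)"
        using eq_mult_int_pow_neg[OF ab x] by blast
    next
      fix i j :: int
      assume ij: "0 \<le> i" "i < int 4" "0 \<le> j" "j < int 2" and *: "a [^] i \<otimes> b [^] j \<in> M"
      then have "i = 0 \<or> i = 1 \<or> i = 2 \<or> i = 3" "j = 0 \<or> j = 1"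
        by auto
      have aiK: "a [^] i \<in> K"
        using aK K by (simp add: subgroup_int_pow_closed)
      have "j \<noteq> 1"
      proof
        assume "j = 1"
        have "b = inv (a [^] i) \<otimes> (a [^] i \<otimes> b)"
          using ab by (simp flip: m_assoc)
        then show False
          using * \<open>j = 1\<close> MK aiK bK ab by (metis K.m_closed K.m_inv_closed int_pow_1 subsetD)
      qed
      then have "j = 0" using ij by simp
      then have "a [^] i \<in> M"
        using * ab by simp
      \<comment> \<open>Doubling the exponent turns i = 1 and i = 3 into a^2, which is not in
        \<open>M\<close>; i = 2 is a^2 already.\<close>
      then have "a [^] (i + i) \<in> M"
        by (metis M.m_closed int_pow_mult ab(1))
      moreover have "a [^] (3 + 3 :: int) = a \<otimes> a"
        using ab ap int_pow_mult[of a 4 2] by simp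
      ultimately show "i = 0 \<and> j = 0"
        using \<open>a [^] i \<in> M\<close> \<open>j = 0\<close> \<open>i = 0 \<or> _\<close> a2M ap by auto
    qed simp_all
    then show ?thesis
      using M(1) by blast
  qed
qed

section \<open>Cayley graphs that are not CCA\<close>

lemma (in comm_group) cayley_edges_iff:
  assumes S: "connection_set G S" and x: "x \<in> carrier G"
  shows "{x, y} \<in> cayley_edges G S \<longleftrightarrow> (\<exists>s\<in>S. y = x \<otimes> s)"
proof
  assume "{x, y} \<in> cayley_edges G S"
  then obtain g s where gs: "g \<in> carrier G" "s \<in> S" "{x, y} = {g, g \<otimes> s}"
    by (auto simp: cayley_edges_def)
  have s: "s \<in> carrier G" "inv s \<in> S"
    using S gs(2) by (auto simp: connection_set_def)
  have "g = (g \<otimes> s) \<otimes> inv s"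
    using gs(1) s(1) by (simp add: m_assoc)
  moreover have "x = g \<and> y = g \<otimes> s \<or> x = g \<otimes> s \<and> y = g"
    using gs(3) by (auto simp: doubleton_eq_iff)
  ultimately show "\<exists>s\<in>S. y = x \<otimes> s"
    using gs(2) s(2) by metis
next
  assume "\<exists>s\<in>S. y = x \<otimes> s"
  then show "{x, y} \<in> cayley_edges G S"
    using x by (auto simp: cayley_edges_def)
qed

text \<open>An involution is its own inverse, so preserving edges in one direction gives the
  other.\<close>

lemma (in comm_group) colour_preserving_involution_automorphism:
  assumes S: "connection_set G S"
    and closed: "\<And>x. x \<in> carrier G \<Longrightarrow> \<phi> x \<in> carrier G"
    and invol: "\<And>x. x \<in> carrier G \<Longrightarrow> \<phi> (\<phi> x) = x"
    and col: "colour_preserving G S \<phi>"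
  shows "cayley_automorphism G S \<phi>"
proof -
  have "bij_betw \<phi> (carrier G) (carrier G)"
    by (rule bij_betw_byWitness[of _ \<phi>]) (use closed invol in auto)
  moreover have edge: "{\<phi> x, \<phi> y} \<in> cayley_edges G S"
    if xy: "x \<in> carrier G" "{x, y} \<in> cayley_edges G S" for x y
  proof -
    obtain s where s: "s \<in> S" "y = x \<otimes> s"
      using xy cayley_edges_iff[OF S] by blast
    then have "inv s \<in> S" "\<phi> y \<in> {\<phi> x \<otimes> s, \<phi> x \<otimes> inv s}"
      using S col xy by (auto simp: connection_set_def colour_preserving_def)
    then show ?thesis
      using s(1) closed[OF xy(1)] cayley_edges_iff[OF S] by auto
  qed
  moreover have "{x, y} \<in> cayley_edges G S"
    if "x \<in> carrier G" "y \<in> carrier G" "{\<phi> x, \<phi> y} \<in> cayley_edges G S" for x y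
    using edge[of "\<phi> x" "\<phi> y"] that closed invol by simp
  ultimately show ?thesis
    unfolding cayley_automorphism_def by blast
qed

lemma (in comm_group) not_CCA_of_nonsquare_four_two:
  assumes "nonsquare_four_two G"
  shows "\<exists>S. connection_set G S \<and> cayley_connected G S \<and> \<not> CCA G S"
proof -
  obtain a b where ab: "a \<in> carrier G" "b \<in> carrier G"
      and a2: "a \<otimes> a \<noteq> \<one>" and a4: "(a \<otimes> a) \<otimes> (a \<otimes> a) = \<one>" and b2: "b \<otimes> b = \<one>"
      and nsq: "a \<notin> squares G" "b \<notin> squares G" "a \<otimes> b \<notin> squares G"
    using assms by (auto simp: nonsquare_four_two_def)
  obtain L where L: "subgroup L G" "squares G \<subseteq> L" "a \<notin> L" "b \<notin> L" "a \<otimes> b \<notin> L"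
    and cosets: "\<And>x. x \<in> carrier G \<Longrightarrow> x \<in> L \<or> a \<otimes> x \<in> L \<or> b \<otimes> x \<in> L \<or> a \<otimes> b \<otimes> x \<in> L"
    using index_four_subgroup[OF ab nsq] by blast
  interpret L: subgroup L G by fact
  have sq: "x \<otimes> x \<in> L" if "x \<in> carrier G" for x
    using that L(2) by (auto simp: squares_def)
  have cancelL: "x \<otimes> y \<in> L \<longleftrightarrow> x \<in> L" if "x \<in> carrier G" "y \<in> L" for x y
  proof
    assume "x \<otimes> y \<in> L"
    moreover have "x = (x \<otimes> y) \<otimes> inv y"
      using that by (simp add: m_assoc)
    ultimately show "x \<in> L"
      using that by (metis L.m_closed L.m_inv_closed)
  qed (use that in simp)
  define T where "T = {a, inv a, a \<otimes> b, inv (a \<otimes> b)}"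
  define S where "S = L \<union> T"
  have T: "s \<in> carrier G" "s \<otimes> s = a \<otimes> a" if "s \<in> T" for s
  proof -
    show "s \<in> carrier G"
      using that ab by (auto simp: T_def)
    have "inv (a \<otimes> a) = a \<otimes> a"
      using a4 ab by (intro inv_equality) simp_all
    then have "inv a \<otimes> inv a = a \<otimes> a"
      using ab by (simp add: inv_mult)
    moreover have "(a \<otimes> b) \<otimes> (a \<otimes> b) = (a \<otimes> a) \<otimes> (b \<otimes> b)"
        "inv (a \<otimes> b) \<otimes> inv (a \<otimes> b) = (inv a \<otimes> inv a) \<otimes> inv (b \<otimes> b)"
      using ab by (simp_all add: inv_mult m_ac)
    ultimately show "s \<otimes> s = a \<otimes> a"
      using that ab b2 by (auto simp: T_def)
  qed
  have "inv s \<in> S" if "s \<in> S" for s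
    using that ab by (auto simp: S_def T_def)
  moreover have SG: "S \<subseteq> carrier G"
    using T(1) by (auto simp: S_def)
  ultimately have S: "connection_set G S"
    unfolding connection_set_def by (auto simp: image_iff) (metis inv_inv subsetD)
  define E where "E = {(u, v). {u, v} \<in> cayley_edges G S}"
  have edge: "(x, x \<otimes> s) \<in> E" if "x \<in> carrier G" "s \<in> S" for x s
    using that by (auto simp: E_def cayley_edges_def)
  have "cayley_connected G S"
    unfolding cayley_connected_def E_def[symmetric]
  proof (intro ballI)
    fix x y assume xy: "x \<in> carrier G" "y \<in> carrier G"
    define w where "w = inv x \<otimes> y"
    have w: "w \<in> carrier G" "y = x \<otimes> w"
      using xy by (simp_all add: w_def flip: m_assoc)
    have one: "\<one> \<in> S" by (simp add: S_def)
    have T': "a \<in> S" "inv a \<in> S" "inv (a \<otimes> b) \<in> S"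
      by (simp_all add: S_def T_def)
    \<comment> \<open>Every w becomes a product of one element of \<open>L\<close> and at most two
      of \<open>T\<close>, padded by the identity. The coset of b contains no element of
      \<open>S\<close>; it is reached through a and the inverse of a b.\<close>
    have w1: "w = (a \<otimes> w) \<otimes> inv a \<otimes> \<one>" "w = (a \<otimes> b \<otimes> w) \<otimes> inv (a \<otimes> b) \<otimes> \<one>"
      using w ab m_comm[of a w] m_comm[of "a \<otimes> b" w] by (simp_all add: m_assoc)
    have "(b \<otimes> w) \<otimes> a \<otimes> inv (a \<otimes> b) = (b \<otimes> inv b) \<otimes> ((a \<otimes> inv a) \<otimes> w)"
      using w(1) ab by (simp add: inv_mult m_ac del: r_inv Units_r_inv)
    then have w2: "w = (b \<otimes> w) \<otimes> a \<otimes> inv (a \<otimes> b)"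
      using w(1) ab by simp
    have "\<exists>s0\<in>S. \<exists>s1\<in>S. \<exists>s2\<in>S. w = s0 \<otimes> s1 \<otimes> s2"
      using cosets[OF w(1)]
    proof (elim disjE)
      assume "w \<in> L"
      moreover have "w = w \<otimes> \<one> \<otimes> \<one>" using w by simp
      ultimately show ?thesis using one by (metis S_def UnI1)
    next
      assume "a \<otimes> w \<in> L"
      then show ?thesis using w1(1) T' one by (metis S_def UnI1)
    next
      assume "b \<otimes> w \<in> L"
      then show ?thesis using w2 T' by (metis S_def UnI1)
    next
      assume "a \<otimes> b \<otimes> w \<in> L"
      then show ?thesis using w1(2) T' one by (metis S_def UnI1)
    qed
    then obtain s0 s1 s2 where s: "s0 \<in> S" "s1 \<in> S" "s2 \<in> S" "w = s0 \<otimes> s1 \<otimes> s2"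
      by blast
    have c: "s0 \<in> carrier G" "s1 \<in> carrier G" "s2 \<in> carrier G"
      using s SG by auto
    have "(x, x \<otimes> s0) \<in> E" "(x \<otimes> s0, x \<otimes> s0 \<otimes> s1) \<in> E"
        "(x \<otimes> s0 \<otimes> s1, x \<otimes> s0 \<otimes> s1 \<otimes> s2) \<in> E"
      using edge s c xy by simp_all
    moreover have "y = x \<otimes> s0 \<otimes> s1 \<otimes> s2"
      using w s c xy by (simp add: m_assoc)
    ultimately show "(x, y) \<in> E\<^sup>*"
      by (metis converse_rtrancl_into_rtrancl r_into_rtrancl)
  qed
  moreover have "\<not> CCA G S"
  proof
    \<comment> \<open>As a^2 is in \<open>L\<close>, the condition that x a lies in \<open>L\<close>
      describes the coset of a.\<close>
    define \<phi> where "\<phi> x = (if x \<otimes> a \<in> L then x \<otimes> (a \<otimes> a) else x)" for x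
    have \<phi>_closed: "\<phi> x \<in> carrier G" if "x \<in> carrier G" for x
      using that ab by (simp add: \<phi>_def)
    have invol: "\<phi> (\<phi> x) = x" if "x \<in> carrier G" for x
    proof -
      have "(x \<otimes> (a \<otimes> a)) \<otimes> a = (x \<otimes> a) \<otimes> (a \<otimes> a)" "(x \<otimes> (a \<otimes> a)) \<otimes> (a \<otimes> a) = x \<otimes> ((a \<otimes> a) \<otimes> (a \<otimes> a))"
        using that ab by (simp_all add: m_ac)
      then show ?thesis
        using that ab a4 cancelL[of "x \<otimes> a", OF _ sq] by (simp add: \<phi>_def)
    qed
    have col: "colour_preserving G S \<phi>"
      unfolding colour_preserving_def
    proof (intro ballI)
      fix g s assume g: "g \<in> carrier G" and s: "s \<in> S"
      show "\<phi> (g \<otimes> s) \<in> {\<phi> g \<otimes> s, \<phi> g \<otimes> inv s}"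
      proof (cases "s \<in> L")
        case True
        have "(g \<otimes> s) \<otimes> a = (g \<otimes> a) \<otimes> s"
          using True g ab by (simp add: m_ac)
        then have "\<phi> (g \<otimes> s) = \<phi> g \<otimes> s"
          using True g ab cancelL[of "g \<otimes> a" s] by (simp add: \<phi>_def m_ac)
        then show ?thesis by simp
      next
        case False
        then have "s \<in> T" using s by (simp add: S_def)
        note T = T[OF this]
        \<comment> \<open>The facts \<open>1\<close>, \<open>2\<close> and \<open>3\<close> treat
          the cases where both ends, only g, or only g s is translated; in the last two, s^2 = a^2
          turns the translation into a change of sign.\<close>
        have 1: "(g \<otimes> s) \<otimes> (a \<otimes> a) = (g \<otimes> (a \<otimes> a)) \<otimes> s"
          using T g ab by (simp add: m_ac)
        have "g \<otimes> (a \<otimes> a) \<otimes> inv s = g \<otimes> (s \<otimes> s) \<otimes> inv s"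
          by (simp only: T(2))
        also have "\<dots> = g \<otimes> s"
          using T(1) g by (simp add: m_assoc)
        finally have 2: "g \<otimes> (a \<otimes> a) \<otimes> inv s = g \<otimes> s" .
        have "(g \<otimes> s) \<otimes> (a \<otimes> a) = (g \<otimes> (a \<otimes> a) \<otimes> inv s) \<otimes> (a \<otimes> a)"
          by (simp only: 2)
        also have "\<dots> = (g \<otimes> inv s) \<otimes> ((a \<otimes> a) \<otimes> (a \<otimes> a))"
          using T(1) g ab by (simp add: m_ac)
        finally have "(g \<otimes> s) \<otimes> (a \<otimes> a) = (g \<otimes> inv s) \<otimes> ((a \<otimes> a) \<otimes> (a \<otimes> a))" .
        then have 3: "(g \<otimes> s) \<otimes> (a \<otimes> a) = g \<otimes> inv s"
          using T(1) g a4 by simp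
        show ?thesis
          using 1 2 3 by (simp add: \<phi>_def)
      qed
    qed
    have aut: "cayley_automorphism G S \<phi>"
      by (rule colour_preserving_involution_automorphism[OF S \<phi>_closed invol col])
    assume "CCA G S"
    then have "affine_bijection G \<phi>"
      using aut col unfolding CCA_def by blast
    then obtain \<tau> c where \<tau>: "\<tau> \<in> iso G G" "c \<in> carrier G" "\<And>x. x \<in> carrier G \<Longrightarrow> \<phi> x = \<tau> x \<otimes> c"
      unfolding affine_bijection_def by blast
    interpret \<tau>: group_hom G G \<tau>
      using \<tau>(1) by (simp add: group_hom_def group_hom_axioms_def iso_imp_homomorphism)
    \<comment> \<open>Since \<open>\<phi>\<close> fixes the identity, being affine makes it a
      homomorphism. It fixes a b and b, hence their product a, yet it sends a to a^3.\<close>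
    have "\<phi> \<one> = \<one>"
      using L(3) ab by (simp add: \<phi>_def)
    then have "c = \<one>"
      using \<tau>(2,3) by simp
    then have hom: "\<phi> (x \<otimes> y) = \<phi> x \<otimes> \<phi> y" if "x \<in> carrier G" "y \<in> carrier G" for x y
      using that \<tau>(3) by simp
    have "a \<otimes> b \<otimes> a = b \<otimes> (a \<otimes> a)" "a \<otimes> b \<otimes> b = a"
      using ab b2 by (simp_all add: m_ac)
    then have "\<phi> (a \<otimes> b) = a \<otimes> b" "\<phi> b = b" "\<phi> a = a \<otimes> (a \<otimes> a)"
      using L ab sq[OF ab(1)] cancelL[of b "a \<otimes> a"] m_comm[of a b] by (simp_all add: \<phi>_def)
    then have "a \<otimes> (a \<otimes> a) = a"
      using hom[of "a \<otimes> b" b] \<open>a \<otimes> b \<otimes> b = a\<close> ab by simp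
    then show False
      using a2 ab by simp
  qed
  ultimately show ?thesis
    using S by blast
qed

section \<open>Colour-permuting automorphisms\<close>

lemma (in group) int_pow_2: "x \<in> carrier G \<Longrightarrow> x [^] (2::int) = x \<otimes> x"
  using int_pow_mult[of x 1 1] by simp

lemma (in comm_group) mult_inv_eq_swap:
  assumes "a \<in> carrier G" "b \<in> carrier G" "c \<in> carrier G" "d \<in> carrier G" "a \<otimes> b = c \<otimes> d"
  shows "a \<otimes> inv d = c \<otimes> inv b"
proof -
  have "(a \<otimes> inv d) \<otimes> b = (a \<otimes> b) \<otimes> inv d"
    using assms(1-4) by (simp add: m_ac)
  also have "\<dots> = c"
    using assms by (simp add: m_assoc)
  finally show ?thesis
    using assms(1-4) by (simp add: inv_solve_right)
qed

section \<open>Periods of functions, and subgroups containing the connection set\<close>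

definition periods :: "('a, 'b) monoid_scheme \<Rightarrow> ('a \<Rightarrow> 'c) \<Rightarrow> 'a set" where
  "periods G F = {x \<in> carrier G. \<forall>g\<in>carrier G. F (g \<otimes>\<^bsub>G\<^esub> x) = F g}"

lemma (in group) periodsD: "x \<in> periods G F \<Longrightarrow> g \<in> carrier G \<Longrightarrow> F (g \<otimes> x) = F g"
  by (simp add: periods_def)

lemma (in group) subgroup_periods: "subgroup (periods G F) G"
proof
  fix x y assume "x \<in> periods G F" "y \<in> periods G F"
  then show "x \<otimes> y \<in> periods G F"
    by (auto simp: periods_def simp flip: m_assoc)
next
  fix x assume x: "x \<in> periods G F"
  then have "F (g \<otimes> inv x) = F g" if "g \<in> carrier G" for g
    using that periodsD[OF x, of "g \<otimes> inv x"] by (auto simp: periods_def m_assoc)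
  then show "inv x \<in> periods G F"
    using x by (auto simp: periods_def)
qed (auto simp: periods_def)

text \<open>A walk from the identity cannot leave a subgroup that contains \<open>S\<close>.\<close>

lemma (in comm_group) connection_set_generates:
  assumes S: "connection_set G S" "cayley_connected G S" and N: "subgroup N G" "S \<subseteq> N"
  shows "carrier G \<subseteq> N"
proof
  interpret N: subgroup N G by fact
  have SG: "S \<subseteq> carrier G"
    using S by (simp add: connection_set_def)
  fix x assume "x \<in> carrier G"
  then have "(\<one>, x) \<in> {(u, v). {u, v} \<in> cayley_edges G S}\<^sup>*"
    using S(2) by (simp add: cayley_connected_def)
  then show "x \<in> N"
  proof induction
    case (step y z)
    then have "y \<in> carrier G" by simp
    then obtain s where "s \<in> S" "z = y \<otimes> s"
      using step cayley_edges_iff[OF S(1)] by auto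
    then show ?case
      using step N(2) by auto
  qed simp
qed

text \<open>Squaring is a homomorphism of an abelian group, so the preimage of \<open>N\<close>
  under it is a subgroup; it contains \<open>S\<close>, hence everything.\<close>

lemma (in comm_group) squares_subset_of_generators:
  assumes S: "connection_set G S" "cayley_connected G S" and N: "subgroup N G"
    and sq: "\<And>s. s \<in> S \<Longrightarrow> s \<otimes> s \<in> N"
  shows "squares G \<subseteq> N"
proof -
  interpret N: subgroup N G by fact
  have SG: "S \<subseteq> carrier G"
    using S by (simp add: connection_set_def)
  have "subgroup {x \<in> carrier G. x \<otimes> x \<in> N} G"
  proof
    fix x y assume "x \<in> {x \<in> carrier G. x \<otimes> x \<in> N}" "y \<in> {x \<in> carrier G. x \<otimes> x \<in> N}"
    moreover from this have "(x \<otimes> y) \<otimes> (x \<otimes> y) = (x \<otimes> x) \<otimes> (y \<otimes> y)"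
      by (simp add: m_ac)
    ultimately show "x \<otimes> y \<in> {x \<in> carrier G. x \<otimes> x \<in> N}"
      by simp
  next
    fix x assume "x \<in> {x \<in> carrier G. x \<otimes> x \<in> N}"
    moreover from this have "inv x \<otimes> inv x = inv (x \<otimes> x)"
      by (simp add: inv_mult)
    ultimately show "inv x \<in> {x \<in> carrier G. x \<otimes> x \<in> N}"
      by simp
  qed auto
  then have "carrier G \<subseteq> {x \<in> carrier G. x \<otimes> x \<in> N}"
    using connection_set_generates[OF S] sq SG by blast
  then show ?thesis
    by (auto simp: squares_def)
qed

section \<open>Signs of a colour-permuting automorphism\<close>

locale colour_permutation = comm_group G for G (structure) +
  fixes S \<phi> \<pi>
  assumes S: "connection_set G S" "cayley_connected G S"
    and automorphism: "cayley_automorphism G S \<phi>"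
    and \<pi>: "bij_betw \<pi> S S"
    and permuting: "\<And>g s. \<lbrakk>g \<in> carrier G; s \<in> S\<rbrakk> \<Longrightarrow> \<phi> (g \<otimes> s) \<in> {\<phi> g \<otimes> \<pi> s, \<phi> g \<otimes> inv (\<pi> s)}"
begin

text \<open>The sign \<open>\<epsilon>\<^sub>s(g)\<close>. It is meaningful only if \<open>\<pi> s\<close> is not an involution; for involutions it is
  the constant 1.\<close>

definition dir :: "'a \<Rightarrow> 'a \<Rightarrow> int" where
  "dir s g = (if \<phi> (g \<otimes> s) = \<phi> g \<otimes> \<pi> s then 1 else -1)"

lemma dir_cases: "dir s g = 1 \<or> dir s g = -1"
  by (simp add: dir_def)

lemma S_carrier [simp]: "s \<in> S \<Longrightarrow> s \<in> carrier G"
  using S by (auto simp: connection_set_def)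

lemma \<pi>_S [simp]: "s \<in> S \<Longrightarrow> \<pi> s \<in> S"
  using \<pi> by (auto dest: bij_betwE)

lemma inv_S [simp]: "s \<in> S \<Longrightarrow> inv s \<in> S"
  using S by (auto simp: connection_set_def)

lemma bij: "bij_betw \<phi> (carrier G) (carrier G)"
  using automorphism by (simp add: cayley_automorphism_def)

lemma \<phi>_closed [simp]: "x \<in> carrier G \<Longrightarrow> \<phi> x \<in> carrier G"
  using bij by (auto dest: bij_betwE)

lemma \<phi>_eq_iff: "\<lbrakk>x \<in> carrier G; y \<in> carrier G\<rbrakk> \<Longrightarrow> \<phi> x = \<phi> y \<longleftrightarrow> x = y"
  using bij by (auto simp: bij_betw_def inj_on_eq_iff)

lemma \<phi>_mult: "\<lbrakk>g \<in> carrier G; s \<in> S\<rbrakk> \<Longrightarrow> \<phi> (g \<otimes> s) = \<phi> g \<otimes> \<pi> s [^] dir s g"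
  using permuting[of g s] by (auto simp: dir_def int_pow_neg)

lemma \<phi>_mult2:
  assumes "g \<in> carrier G" "s \<in> S" "u \<in> S"
  shows "\<phi> (g \<otimes> s \<otimes> u) = \<phi> g \<otimes> (\<pi> s [^] dir s g \<otimes> \<pi> u [^] dir u (g \<otimes> s))"
proof -
  have "\<phi> (g \<otimes> s \<otimes> u) = \<phi> (g \<otimes> s) \<otimes> \<pi> u [^] dir u (g \<otimes> s)"
    using assms by (intro \<phi>_mult) simp_all
  then show ?thesis
    using assms by (simp add: \<phi>_mult[of g s] m_assoc)
qed

lemma \<phi>_mult_self:
  assumes "g \<in> carrier G" "s \<in> S"
  shows "\<phi> (g \<otimes> s \<otimes> s) = \<phi> g \<otimes> \<pi> s [^] (dir s g + dir s (g \<otimes> s))"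
  using assms by (simp add: \<phi>_mult2 int_pow_mult)

text \<open>The paths from g to g s u through g s and through g u have images with the same end.
  Both exponents are 0, 2 or -2.\<close>

lemma dir_exchange:
  assumes g: "g \<in> carrier G" and su: "s \<in> S" "u \<in> S"
  shows "\<pi> s [^] (dir s g - dir s (g \<otimes> u)) = \<pi> u [^] (dir u g - dir u (g \<otimes> s))"
proof -
  have "g \<otimes> s \<otimes> u = g \<otimes> u \<otimes> s"
    using g su by (simp add: m_ac)
  then have "\<pi> s [^] dir s g \<otimes> \<pi> u [^] dir u (g \<otimes> s) = \<pi> u [^] dir u g \<otimes> \<pi> s [^] dir s (g \<otimes> u)"
    using \<phi>_mult2[OF g su] \<phi>_mult2[OF g su(2,1)] g su by simp
  then show ?thesis
    using su by (simp add: int_pow_diff mult_inv_eq_swap)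
qed

text \<open>A change of \<open>dir s\<close> makes the left side of \<open>dir_exchange\<close> the
  nontrivial square of \<open>\<pi> s\<close> or its inverse, so the exponent on the right is 2 or
  -2 as well.\<close>

lemma dir_change:
  assumes g: "g \<in> carrier G" and su: "s \<in> S" "u \<in> S"
    and ne: "dir s g \<noteq> dir s (g \<otimes> u)" and s2: "\<pi> s \<otimes> \<pi> s \<noteq> \<one>"
  shows "dir u g \<noteq> dir u (g \<otimes> s)"
    and "\<pi> u \<otimes> \<pi> u = \<pi> s \<otimes> \<pi> s \<or> \<pi> u \<otimes> \<pi> u = inv (\<pi> s \<otimes> \<pi> s)"
proof -
  have p: "\<pi> s [^] (2::int) = \<pi> s \<otimes> \<pi> s" "\<pi> s [^] (-2::int) = inv (\<pi> s \<otimes> \<pi> s)"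
      "\<pi> u [^] (2::int) = \<pi> u \<otimes> \<pi> u" "\<pi> u [^] (-2::int) = inv (\<pi> u \<otimes> \<pi> u)"
    using su int_pow_neg[of _ 2] by (simp_all add: int_pow_2)
  note ex = dir_exchange[OF g su]
  have ds: "dir s g - dir s (g \<otimes> u) = 2 \<or> dir s g - dir s (g \<otimes> u) = -2"
    using ne dir_cases[of s g] dir_cases[of s "g \<otimes> u"] by auto
  then have "\<pi> s [^] (dir s g - dir s (g \<otimes> u)) \<noteq> \<one>"
    using p s2 su by auto
  then show du: "dir u g \<noteq> dir u (g \<otimes> s)"
    using ex by auto
  then have "dir u g - dir u (g \<otimes> s) = 2 \<or> dir u g - dir u (g \<otimes> s) = -2"
    using dir_cases[of u g] dir_cases[of u "g \<otimes> s"] by auto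
  then show "\<pi> u \<otimes> \<pi> u = \<pi> s \<otimes> \<pi> s \<or> \<pi> u \<otimes> \<pi> u = inv (\<pi> s \<otimes> \<pi> s)"
    using ds ex su unfolding p(1,2)[symmetric] p(3)[symmetric]
    by (elim disjE) (simp_all add: int_pow_neg, metis inv_inv int_pow_closed S_carrier \<pi>_S)
qed

text \<open>Two steps of a long colour, one with s^2 nontrivial, do not lead back. As
  \<open>\<phi>\<close> is injective, neither do their images, so the signs do not cancel.\<close>

lemma dir_along_long_colour:
  assumes g: "g \<in> carrier G" and s: "s \<in> S" "s \<otimes> s \<noteq> \<one>"
  shows "dir s (g \<otimes> s) = dir s g" and "\<pi> s \<otimes> \<pi> s \<noteq> \<one>"
proof -
  have "g \<otimes> s \<otimes> s \<noteq> g"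
    using g s by (simp add: m_assoc)
  then have "\<phi> (g \<otimes> s \<otimes> s) \<noteq> \<phi> g"
    using g s by (simp add: \<phi>_eq_iff)
  then have ne: "\<pi> s [^] (dir s g + dir s (g \<otimes> s)) \<noteq> \<one>"
    using \<phi>_mult_self[OF g s(1)] g by auto
  then show eq: "dir s (g \<otimes> s) = dir s g"
    using dir_cases[of s g] dir_cases[of s "g \<otimes> s"] by auto
  have "\<pi> s [^] (-2::int) = inv (\<pi> s [^] (2::int))"
    using s by (intro int_pow_neg) simp
  then show "\<pi> s \<otimes> \<pi> s \<noteq> \<one>"
    using ne s dir_cases[of s g] unfolding eq by (auto simp: int_pow_2)
qed

text \<open>Both steps have the same sign, and by \<open>p4\<close> the square of
  \<open>\<pi> s\<close> is its own inverse.\<close>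

lemma \<phi>_mult_long_colour:
  assumes g: "g \<in> carrier G" and s: "s \<in> S" "s \<otimes> s \<noteq> \<one>"
    and p4: "(\<pi> s \<otimes> \<pi> s) \<otimes> (\<pi> s \<otimes> \<pi> s) = \<one>"
  shows "\<phi> (g \<otimes> (s \<otimes> s)) = \<phi> g \<otimes> (\<pi> s \<otimes> \<pi> s)"
proof -
  have "inv (\<pi> s \<otimes> \<pi> s) = \<pi> s \<otimes> \<pi> s"
    using p4 s by (intro inv_equality) simp_all
  then have "\<pi> s [^] (-2::int) = \<pi> s \<otimes> \<pi> s"
    using s int_pow_neg[of "\<pi> s" 2] by (simp add: int_pow_2)
  then have "\<pi> s [^] (dir s g + dir s g) = \<pi> s \<otimes> \<pi> s"
    using s dir_cases[of s g] by (auto simp: int_pow_2)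
  then show ?thesis
    using \<phi>_mult_self[OF g s(1)] dir_along_long_colour(1)[OF g s] g s by (simp add: m_assoc)
qed

text \<open>If \<open>\<pi> x\<close> and \<open>\<pi> s\<close> have the same square, two steps of
  colour x move the image by 1 or by that square, so x^2 is 1 or \<open>d\<close>. Along any other
  colour x, \<open>dir_change\<close> keeps \<open>dir s\<close> constant, and x itself is a
  period.\<close>

lemma squares_subset_periods_dir:
  assumes s: "s \<in> S" "\<pi> s \<otimes> \<pi> s \<noteq> \<one>" "(\<pi> s \<otimes> \<pi> s) \<otimes> (\<pi> s \<otimes> \<pi> s) = \<one>"
    and d: "d \<in> periods G (dir s)" and \<phi>d: "\<And>g. g \<in> carrier G \<Longrightarrow> \<phi> (g \<otimes> d) = \<phi> g \<otimes> (\<pi> s \<otimes> \<pi> s)"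
  shows "squares G \<subseteq> periods G (dir s)"
proof (rule squares_subset_of_generators[OF S subgroup_periods])
  have inv_p: "inv (\<pi> s \<otimes> \<pi> s) = \<pi> s \<otimes> \<pi> s"
    using s by (intro inv_equality) simp_all
  fix x assume x: "x \<in> S"
  show "x \<otimes> x \<in> periods G (dir s)"
  proof (cases "\<pi> x \<otimes> \<pi> x = \<pi> s \<otimes> \<pi> s")
    case True
    then have "\<pi> x [^] (2::int) = \<pi> s \<otimes> \<pi> s" "\<pi> x [^] (-2::int) = \<pi> s \<otimes> \<pi> s"
      using x inv_p int_pow_neg[of "\<pi> x" 2] by (simp_all add: int_pow_2)
    then have "\<phi> (\<one> \<otimes> x \<otimes> x) = \<phi> \<one> \<or> \<phi> (\<one> \<otimes> x \<otimes> x) = \<phi> (\<one> \<otimes> d)"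
      using \<phi>_mult_self[OF one_closed x] dir_cases[of x \<one>] dir_cases[of x "\<one> \<otimes> x"] \<phi>d[OF one_closed]
      by auto
    moreover have "d \<in> carrier G"
      using d by (simp add: periods_def)
    ultimately have "x \<otimes> x = \<one> \<or> x \<otimes> x = d"
      using x by (simp add: \<phi>_eq_iff)
    then show ?thesis
      using d subgroup.one_closed[OF subgroup_periods] by auto
  next
    case False
    have "dir s (g \<otimes> x) = dir s g" if "g \<in> carrier G" for g
      by (rule ccontr) (use dir_change(2)[OF that s(1) x _ s(2)] False inv_p in auto)
    then have "x \<in> periods G (dir s)"
      using x by (simp add: periods_def)
    then show ?thesis
      using subgroup.m_closed[OF subgroup_periods] by blast
  qed
qed

text \<open>When \<open>\<epsilon>\<^sub>s\<close> changes along \<open>u\<close>, the exchange relations at \<open>g\<close> and at \<open>g + s\<close> have the same left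
  side, since \<open>\<epsilon>\<^sub>s\<close> is constant along \<open>s\<close>, and opposite right sides. Hence \<open>4\<pi>(s) = 0\<close>.\<close>

lemma long_colours_exchange:
  assumes g: "g \<in> carrier G" and s: "s \<in> S" "s \<otimes> s \<noteq> \<one>" and u: "u \<in> S" "u \<otimes> u \<noteq> \<one>"
    and ne: "dir s g \<noteq> dir s (g \<otimes> u)"
  shows "(s \<otimes> s) \<otimes> (s \<otimes> s) = \<one>" and "s \<otimes> s = u \<otimes> u"
    and "u \<notin> squares G" and "u \<otimes> s \<notin> squares G" and "dir u g \<noteq> dir u (g \<otimes> s)"
proof -
  note p2 = dir_along_long_colour(2)[OF one_closed s]
  note change = dir_change[OF g s(1) u(1) ne p2]
  show ne': "dir u g \<noteq> dir u (g \<otimes> s)"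
    by (rule change(1))
  let ?d = "dir s g - dir s (g \<otimes> u)"
  have "(g \<otimes> s) \<otimes> u = g \<otimes> u \<otimes> s"
    using g s u by (simp add: m_ac)
  then have "dir s (g \<otimes> s \<otimes> u) = dir s (g \<otimes> u)"
    using dir_along_long_colour(1)[OF _ s] g u by simp
  moreover have "dir s (g \<otimes> s) = dir s g"
    using dir_along_long_colour(1)[OF g s] .
  ultimately have eq: "\<pi> s [^] ?d = \<pi> u [^] (dir u (g \<otimes> s) - dir u (g \<otimes> s \<otimes> s))"
    using dir_exchange[of "g \<otimes> s" s u] g s u by simp
  have ex: "\<pi> s [^] ?d = \<pi> u [^] (dir u g - dir u (g \<otimes> s))"
    using dir_exchange[OF g s(1) u(1)] .
  have d: "?d = 2 \<or> ?d = -2"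
    using ne dir_cases[of s g] dir_cases[of s "g \<otimes> u"] by auto
  then have d1: "\<pi> s [^] ?d \<noteq> \<one>"
    using p2 s int_pow_neg[of "\<pi> s" 2] by (auto simp: int_pow_2)
  then have opp: "dir u (g \<otimes> s) - dir u (g \<otimes> s \<otimes> s) = - (dir u g - dir u (g \<otimes> s))"
    using dir_cases[of u g] dir_cases[of u "g \<otimes> s"] dir_cases[of u "g \<otimes> s \<otimes> s"] ne' eq ex by auto
  have "\<pi> s [^] ?d = inv (\<pi> s [^] ?d)"
    using eq int_pow_neg[of "\<pi> u" "dir u g - dir u (g \<otimes> s)"] u unfolding opp ex[symmetric] by simp
  then have "\<pi> s [^] ?d \<otimes> \<pi> s [^] ?d = \<one>"
    using s by (metis S_carrier \<pi>_S int_pow_closed r_inv)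
  then have "\<pi> s [^] (2::int) \<otimes> \<pi> s [^] (2::int) = \<one>"
    using d s int_pow_neg[of "\<pi> s" 2] by (auto simp flip: inv_mult)
  then have p4: "(\<pi> s \<otimes> \<pi> s) \<otimes> (\<pi> s \<otimes> \<pi> s) = \<one>"
    using s by (simp add: int_pow_2)
  then have "inv (\<pi> s \<otimes> \<pi> s) = \<pi> s \<otimes> \<pi> s"
    using s by (intro inv_equality) simp_all
  then have q2: "\<pi> u \<otimes> \<pi> u = \<pi> s \<otimes> \<pi> s"
    using change(2) by auto
  have \<phi>d: "\<phi> (h \<otimes> (s \<otimes> s)) = \<phi> h \<otimes> (\<pi> s \<otimes> \<pi> s)" if "h \<in> carrier G" for h
    by (rule \<phi>_mult_long_colour[OF that s p4])
  have "\<phi> (\<one> \<otimes> (s \<otimes> s)) = \<phi> (\<one> \<otimes> (u \<otimes> u))"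
    using \<phi>_mult_long_colour[OF one_closed u] p4 q2 \<phi>d[OF one_closed] by simp
  then show "s \<otimes> s = u \<otimes> u"
    using s u by (simp add: \<phi>_eq_iff)
  have "\<phi> (s \<otimes> s \<otimes> (s \<otimes> s)) = \<phi> \<one> \<otimes> ((\<pi> s \<otimes> \<pi> s) \<otimes> (\<pi> s \<otimes> \<pi> s))"
    using \<phi>d[of "s \<otimes> s"] \<phi>d[OF one_closed] s by (simp add: m_assoc)
  then show "(s \<otimes> s) \<otimes> (s \<otimes> s) = \<one>"
    using p4 s by (simp add: \<phi>_eq_iff)
  \<comment> \<open>This makes s^2 a period, so it can serve as \<open>d\<close> in
    \<open>squares_subset_periods_dir\<close>. The sign changes along u and along u s, which
    therefore are not squares.\<close>
  have "s \<in> periods G (dir s)"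
    using dir_along_long_colour(1)[OF _ s] s by (simp add: periods_def)
  then have "s \<otimes> s \<in> periods G (dir s)"
    using subgroup.m_closed[OF subgroup_periods] by blast
  then have sq: "squares G \<subseteq> periods G (dir s)"
    by (rule squares_subset_periods_dir[OF s(1) p2 p4 _ \<phi>d])
  show "u \<notin> squares G"
    using sq periodsD[of u "dir s", OF _ g] ne by auto
  have "dir s (g \<otimes> (u \<otimes> s)) = dir s (g \<otimes> u)"
    using dir_along_long_colour(1)[OF _ s, of "g \<otimes> u"] g s u by (simp add: m_assoc)
  then show "u \<otimes> s \<notin> squares G"
    using sq periodsD[of "u \<otimes> s" "dir s", OF _ g] ne by auto
qed

text \<open>The witnesses are a = s and b = u s^-1, with a b = u. By the last part of
  \<open>long_colours_exchange\<close> the roles of s and u can be swapped, so s is not a square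
  either. Finally b^2 = 1 by s^2 = u^2, and b s^2 is the nonsquare u s.\<close>

lemma nonsquare_four_two_of_long_colours:
  assumes g: "g \<in> carrier G" and s: "s \<in> S" "s \<otimes> s \<noteq> \<one>" and u: "u \<in> S" "u \<otimes> u \<noteq> \<one>"
    and ne: "dir s g \<noteq> dir s (g \<otimes> u)"
  shows "nonsquare_four_two G"
proof -
  note su = long_colours_exchange[OF g s u ne]
  have "s \<notin> squares G"
    by (rule long_colours_exchange(3)[OF g u s su(5)])
  have "s \<otimes> (u \<otimes> inv s) = u \<otimes> (s \<otimes> inv s)"
    using s u by (intro m_lcomm) simp_all
  then have b: "u \<otimes> inv s \<in> carrier G" "s \<otimes> (u \<otimes> inv s) = u"
    using s u by simp_all
  have "(u \<otimes> inv s) \<otimes> (u \<otimes> inv s) = (u \<otimes> u) \<otimes> inv (s \<otimes> s)"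
    using s u by (simp add: inv_mult m_ac)
  then have "(u \<otimes> inv s) \<otimes> (u \<otimes> inv s) = \<one>"
    using su(2) u by simp
  moreover have "u \<otimes> inv s \<notin> squares G"
  proof
    assume "u \<otimes> inv s \<in> squares G"
    moreover have "s \<otimes> s \<in> squares G"
      using s by (auto simp: squares_def)
    ultimately have "(u \<otimes> inv s) \<otimes> (s \<otimes> s) \<in> squares G"
      using subgroup.m_closed[OF subgroup_squares] by blast
    moreover have "(u \<otimes> inv s) \<otimes> (s \<otimes> s) = u \<otimes> (inv s \<otimes> s) \<otimes> s"
      using s u by (simp add: m_assoc del: l_inv Units_l_inv)
    ultimately show False
      using su(4) s u by simp
  qed
  ultimately show ?thesis
    unfolding nonsquare_four_two_def using su \<open>s \<notin> squares G\<close> s b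
    by (intro bexI[of _ s] bexI[of _ "u \<otimes> inv s"]) auto
qed

text \<open>An automorphism also reflects edges, so the preimages are adjacent; the colour x between
  them is then tied to y by the permuting condition.\<close>

lemma preimage_of_neighbour:
  assumes h: "h \<in> carrier G" and y: "y \<in> S"
  shows "\<exists>x\<in>S. inv_into (carrier G) \<phi> (h \<otimes> y) = inv_into (carrier G) \<phi> h \<otimes> x \<and> (\<pi> x = y \<or> \<pi> x = inv y)"
proof -
  define g k where "g = inv_into (carrier G) \<phi> h" and "k = inv_into (carrier G) \<phi> (h \<otimes> y)"
  have gk: "g \<in> carrier G" "\<phi> g = h" "k \<in> carrier G" "\<phi> k = h \<otimes> y"
    using bij h y unfolding g_def k_def
    by (auto simp: bij_betw_def intro!: inv_into_into f_inv_into_f)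
  have "{\<phi> g, \<phi> k} \<in> cayley_edges G S"
    using gk h y cayley_edges_iff[OF S(1)] by auto
  then have "{g, k} \<in> cayley_edges G S"
    using automorphism gk by (simp add: cayley_automorphism_def)
  then obtain x where x: "x \<in> S" "k = g \<otimes> x"
    using cayley_edges_iff[OF S(1)] gk by blast
  then have "h \<otimes> y \<in> {h \<otimes> \<pi> x, h \<otimes> inv (\<pi> x)}"
    using permuting[OF gk(1) x(1)] gk by simp
  then have "y = \<pi> x \<or> y = inv (\<pi> x)"
    using h x y by auto
  then show ?thesis
    using x by (auto simp: g_def k_def)
qed

text \<open>An involution \<open>s\<close> may be mapped to a colour \<open>r = \<pi> s\<close> that is not an involution: \<open>\<phi>\<close> can turn the
  4-cycles spanned by two involutions \<open>s\<close>, \<open>z\<close> into cosets of \<open>\<langle>r\<rangle>\<close>. Then \<open>r\<close> has order 4, and \<open>r\<close>, \<open>s\<close>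
  are the elements sought; \<open>r\<close> is not a square because the squares are also periods of \<open>\<epsilon>\<^sub>s \<circ> \<phi>\<^sup>-\<^sup>1\<close>.\<close>

lemma nonsquare_four_two_of_short_colour:
  assumes s: "s \<in> S" "s \<otimes> s = \<one>" "\<pi> s \<otimes> \<pi> s \<noteq> \<one>"
  shows "nonsquare_four_two G"
proof -
  define r where "r = \<pi> s"
  have r: "r \<in> S" "r \<in> carrier G" "r \<otimes> r \<noteq> \<one>" "inv r \<in> S"
    using s by (simp_all add: r_def)
  obtain z where z: "z \<in> S" "\<pi> z = inv r"
    using \<pi> r(4) by (metis bij_betw_imp_surj_on imageE)
  have "r \<noteq> inv r"
    using r by (metis r_inv)
  then have zs: "z \<noteq> s"
    using z by (auto simp: r_def)
  have rpow: "r [^] (-1::int) = inv r" "r [^] (2::int) = r \<otimes> r" "r [^] (-2::int) = inv (r \<otimes> r)"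
    using r int_pow_neg[of r] by (simp_all add: int_pow_2)
  have \<phi>s: "\<phi> (g \<otimes> s) = \<phi> g \<otimes> r [^] dir s g" if "g \<in> carrier G" for g
    using \<phi>_mult[OF that s(1)] by (simp add: r_def)
  \<comment> \<open>Two steps of s lead back, but r^2 is nontrivial, so the signs cancel.\<close>
  have dir_s: "dir s (g \<otimes> s) = - dir s g" if g: "g \<in> carrier G" for g
  proof -
    have "\<phi> g \<otimes> r [^] (dir s g + dir s (g \<otimes> s)) = \<phi> g"
      using \<phi>_mult_self[OF g s(1)] g s by (simp add: r_def m_assoc)
    then have "r [^] (dir s g + dir s (g \<otimes> s)) = \<one>"
      using g r by simp
    then show ?thesis
      using dir_cases[of s g] dir_cases[of s "g \<otimes> s"] rpow r by auto
  qed
  \<comment> \<open>The images of g s and g z are distinct neighbours along r, so z takes the sign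
    opposite to that of s.\<close>
  have \<phi>z: "\<phi> (g \<otimes> z) = \<phi> g \<otimes> r [^] (- dir s g)" if g: "g \<in> carrier G" for g
  proof -
    have "\<phi> (g \<otimes> z) \<noteq> \<phi> (g \<otimes> s)"
      using g s z zs by (simp add: \<phi>_eq_iff)
    then show ?thesis
      using permuting[OF g z(1)] \<phi>s[OF g] g z r rpow dir_cases[of s g] by auto
  qed
  have dir_z: "dir s (g \<otimes> z) = - dir s g" if g: "g \<in> carrier G" for g
  proof -
    have "\<phi> (g \<otimes> z \<otimes> s) = \<phi> g \<otimes> (r [^] (- dir s g) \<otimes> r [^] dir s (g \<otimes> z))"
      using \<phi>s[of "g \<otimes> z"] \<phi>z[OF g] g z r by (simp add: m_assoc)
    also have "r [^] (- dir s g) \<otimes> r [^] dir s (g \<otimes> z) = r [^] (- dir s g + dir s (g \<otimes> z))"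
      using r by (intro int_pow_mult[symmetric])
    finally have "\<phi> (g \<otimes> z \<otimes> s) = \<phi> g \<otimes> r [^] (- dir s g + dir s (g \<otimes> z))" .
    moreover have "z \<otimes> s \<noteq> \<one>"
      using zs s z by (metis S_carrier inv_equality)
    then have "g \<otimes> z \<otimes> s \<noteq> g"
      using g s z by (simp add: m_assoc)
    then have "\<phi> (g \<otimes> z \<otimes> s) \<noteq> \<phi> g"
      using g s z by (simp add: \<phi>_eq_iff)
    ultimately show ?thesis
      using dir_cases[of s g] dir_cases[of s "g \<otimes> z"] g by auto
  qed
  have \<phi>sz: "\<phi> (g \<otimes> s \<otimes> z) = \<phi> g \<otimes> r [^] (2 * dir s g)" if g: "g \<in> carrier G" for g
  proof -
    have "\<phi> (g \<otimes> s \<otimes> z) = \<phi> g \<otimes> (r [^] dir s g \<otimes> r [^] dir s g)"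
      using \<phi>z[of "g \<otimes> s"] \<phi>s[OF g] dir_s[OF g] g s r by (simp add: m_assoc)
    also have "r [^] dir s g \<otimes> r [^] dir s g = r [^] (dir s g + dir s g)"
      using r by (intro int_pow_mult[symmetric])
    finally show ?thesis by simp
  qed
  \<comment> \<open>The paths via z and via s to the same vertex have image displacements r^2 and
    r^-2 in some order, whence r^4 = 1.\<close>
  have "\<phi> (\<one> \<otimes> z \<otimes> s) = \<phi> \<one> \<otimes> (r [^] (- dir s \<one>) \<otimes> r [^] (- dir s \<one>))"
    using \<phi>s[of "\<one> \<otimes> z"] \<phi>z[OF one_closed] dir_z[OF one_closed] z r by (simp add: m_assoc)
  moreover have "\<one> \<otimes> z \<otimes> s = \<one> \<otimes> s \<otimes> z"
    using s z by (simp add: m_comm)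
  ultimately have "\<phi> \<one> \<otimes> r [^] (2 * dir s \<one>) = \<phi> \<one> \<otimes> (r [^] (- dir s \<one>) \<otimes> r [^] (- dir s \<one>))"
    using \<phi>sz[OF one_closed] by metis
  then have "r [^] (2 * dir s \<one>) = r [^] (- dir s \<one>) \<otimes> r [^] (- dir s \<one>)"
    using r by simp
  then have "r [^] (2::int) = inv (r [^] (2::int))"
    using dir_cases[of s \<one>] r rpow by (auto simp: inv_mult)
  then have r4: "(r \<otimes> r) \<otimes> (r \<otimes> r) = \<one>"
    using rpow r by (metis m_closed r_inv)
  then have inv_r2: "inv (r \<otimes> r) = r \<otimes> r"
    using r by (intro inv_equality) simp_all
  \<comment> \<open>\<open>dir s\<close> flips along both s and z, so d is a period, and it moves
    images by r^2, as \<open>squares_subset_periods_dir\<close> requires.\<close>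
  define d where "d = s \<otimes> z"
  have d: "d \<in> carrier G"
    using s z by (simp add: d_def)
  have \<phi>d: "\<phi> (g \<otimes> d) = \<phi> g \<otimes> (r \<otimes> r)" if "g \<in> carrier G" for g
    using \<phi>sz[OF that] that s z dir_cases[of s g] rpow inv_r2 by (auto simp: d_def m_assoc)
  have d_per: "d \<in> periods G (dir s)"
    using dir_s dir_z s z by (auto simp: periods_def d_def simp flip: m_assoc)
  have sq: "squares G \<subseteq> periods G (dir s)"
    using squares_subset_periods_dir[OF s(1,3) _ d_per] r4 \<phi>d by (simp add: r_def)
  have unchanged: "dir s (g \<otimes> x) = dir s g"
    if "g \<in> carrier G" "x \<in> S" "\<pi> x \<otimes> \<pi> x \<noteq> r \<otimes> r" for g x
    by (rule ccontr) (use dir_change(2)[OF that(1) s(1) that(2) _ s(3)] that(3) inv_r2 in \<open>auto simp: r_def\<close>)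
  have s_nsq: "s \<notin> squares G"
    using sq periodsD[of s "dir s" \<one>] dir_s[OF one_closed] dir_cases[of s \<one>] by auto
  have rs_nsq: "r \<otimes> s \<notin> squares G"
  proof
    assume rs: "r \<otimes> s \<in> squares G"
    \<comment> \<open>Since s flips the sign and the square r s must keep it, constancy along r is
      contradictory.\<close>
    have "dir s (\<one> \<otimes> r) = dir s \<one>"
    proof (cases "\<pi> r \<otimes> \<pi> r = r \<otimes> r")
      case False
      then show ?thesis
        using unchanged[OF one_closed r(1)] by simp
    next
      case True
      \<comment> \<open>In this case r and r s are periods of \<open>dir r\<close>, hence so is s. A
        change of \<open>dir s\<close> along r would make \<open>dir r\<close> change along
        s.\<close>
      have r_per: "r \<in> periods G (dir r)"
        using dir_along_long_colour(1)[OF _ r(1,3)] r by (simp add: periods_def)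
      then have "r \<otimes> r \<in> periods G (dir r)"
        using subgroup.m_closed[OF subgroup_periods] by blast
      then have "squares G \<subseteq> periods G (dir r)"
        using squares_subset_periods_dir[of r "r \<otimes> r"] \<phi>_mult_long_colour[OF _ r(1,3)] True r r4 by simp
      then have "r \<otimes> s \<in> periods G (dir r)"
        using rs by blast
      then have "inv r \<otimes> (r \<otimes> s) \<in> periods G (dir r)"
        using r_per subgroup.m_closed[OF subgroup_periods] subgroup.m_inv_closed[OF subgroup_periods] by blast
      then have "s \<in> periods G (dir r)"
        using r s by (simp flip: m_assoc)
      then have "dir r \<one> = dir r (\<one> \<otimes> s)"
        using periodsD[of s "dir r" \<one>] by simp
      then show ?thesis
        using dir_change(1)[OF one_closed s(1) r(1) _ s(3)] by fastforce
    qed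
    moreover have "dir s (\<one> \<otimes> (r \<otimes> s)) = dir s \<one>"
      using sq rs periodsD[of "r \<otimes> s" "dir s" \<one>] by auto
    moreover have "dir s (\<one> \<otimes> (r \<otimes> s)) = - dir s (\<one> \<otimes> r)"
      using dir_s[of r] r s by simp
    ultimately show False
      using dir_cases[of s \<one>] by auto
  qed
  have r_nsq: "r \<notin> squares G"
  proof
    assume rsq: "r \<in> squares G"
    define \<psi> where "\<psi> = inv_into (carrier G) \<phi>"
    have \<psi>: "\<psi> h \<in> carrier G" "\<phi> (\<psi> h) = h" if "h \<in> carrier G" for h
      using bij that unfolding \<psi>_def by (auto simp: bij_betw_def intro!: inv_into_into f_inv_into_f)
    have "squares G \<subseteq> periods G (\<lambda>h. dir s (\<psi> h))"
    proof (rule squares_subset_of_generators[OF S subgroup_periods])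
      fix y assume y: "y \<in> S"
      show "y \<otimes> y \<in> periods G (\<lambda>h. dir s (\<psi> h))"
      proof (cases "y \<otimes> y = r \<otimes> r")
        case True
        have "\<psi> (h \<otimes> (r \<otimes> r)) = \<psi> h \<otimes> d" if h: "h \<in> carrier G" for h
        proof -
          have "\<phi> (\<psi> (h \<otimes> (r \<otimes> r))) = \<phi> (\<psi> h \<otimes> d)"
            using \<psi>[of h] \<psi>[of "h \<otimes> (r \<otimes> r)"] \<phi>d[of "\<psi> h"] h r by simp
          then show ?thesis
            using \<psi>[of h] \<psi>[of "h \<otimes> (r \<otimes> r)"] h r d by (simp add: \<phi>_eq_iff)
        qed
        then show ?thesis
          unfolding True using r \<psi> periodsD[OF d_per] by (simp add: periods_def)
      next
        case False
        have "dir s (\<psi> (h \<otimes> y)) = dir s (\<psi> h)" if h: "h \<in> carrier G" for h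
        proof -
          obtain x where x: "x \<in> S" "\<psi> (h \<otimes> y) = \<psi> h \<otimes> x" "\<pi> x = y \<or> \<pi> x = inv y"
            using preimage_of_neighbour[OF h y] unfolding \<psi>_def by blast
          have "inv y \<otimes> inv y \<noteq> r \<otimes> r"
            using False y r inv_r2 by (metis S_carrier inv_inv inv_mult m_closed)
          then show ?thesis
            using x False unchanged[OF \<psi>(1)[OF h] x(1)] by auto
        qed
        then have "y \<in> periods G (\<lambda>h. dir s (\<psi> h))"
          using y by (simp add: periods_def)
        then show ?thesis
          using subgroup.m_closed[OF subgroup_periods] by blast
      qed
    qed
    then have "dir s (\<psi> (\<one> \<otimes> r)) = dir s (\<psi> \<one>)"
      using rsq periodsD[of r "\<lambda>h. dir s (\<psi> h)" \<one>] by auto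
    moreover obtain x where x: "x \<in> S" "\<psi> (\<one> \<otimes> r) = \<psi> \<one> \<otimes> x" "\<pi> x = r \<or> \<pi> x = inv r"
      using preimage_of_neighbour[OF one_closed r(1)] unfolding \<psi>_def by blast
    \<comment> \<open>Injectivity of \<open>\<pi>\<close> leaves only these two colours, and
      \<open>dir s\<close> flips along both.\<close>
    have "x = s \<or> x = z"
      using x s(1) z \<pi> by (metis bij_betw_def inj_onD r_def)
    then have "dir s (\<psi> \<one> \<otimes> x) = - dir s (\<psi> \<one>)"
      using dir_s dir_z \<psi>(1)[OF one_closed] by auto
    ultimately show False
      using x dir_cases[of s "\<psi> \<one>"] by auto
  qed
  show ?thesis
    unfolding nonsquare_four_two_def using r r4 s s_nsq rs_nsq r_nsq
    by (intro bexI[of _ r] bexI[of _ s]) auto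
qed

text \<open>The elements along which \<open>\<phi>\<close> moves all vertices by the same amount
  form a subgroup. It contains \<open>S\<close>, because either sign gives the same displacement if
  \<open>\<pi> s\<close> is its own inverse. So dividing \<open>\<phi>\<close> by its value at the
  identity gives a homomorphism.\<close>

lemma affine_if_dir_constant:
  assumes const: "\<And>s g. \<lbrakk>s \<in> S; \<pi> s \<otimes> \<pi> s \<noteq> \<one>; g \<in> carrier G\<rbrakk> \<Longrightarrow> dir s g = dir s \<one>"
  shows "affine_bijection G \<phi>"
proof -
  let ?N = "{x \<in> carrier G. \<exists>c\<in>carrier G. \<forall>g\<in>carrier G. \<phi> (g \<otimes> x) = \<phi> g \<otimes> c}"
  have "subgroup ?N G"
  proof
    fix x y assume "x \<in> ?N" "y \<in> ?N"
    then obtain c d where "x \<in> carrier G" "y \<in> carrier G" "c \<in> carrier G" "d \<in> carrier G"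
        "\<And>g. g \<in> carrier G \<Longrightarrow> \<phi> (g \<otimes> x) = \<phi> g \<otimes> c" "\<And>g. g \<in> carrier G \<Longrightarrow> \<phi> (g \<otimes> y) = \<phi> g \<otimes> d"
      by blast
    then show "x \<otimes> y \<in> ?N"
      by (auto simp flip: m_assoc) (auto simp: m_assoc)
  next
    fix x assume "x \<in> ?N"
    then obtain c where xc: "x \<in> carrier G" "c \<in> carrier G"
        "\<And>g. g \<in> carrier G \<Longrightarrow> \<phi> (g \<otimes> x) = \<phi> g \<otimes> c"
      by blast
    have "\<phi> (g \<otimes> inv x) = \<phi> g \<otimes> inv c" if "g \<in> carrier G" for g
      using xc(3)[of "g \<otimes> inv x"] that xc(1,2) by (simp add: m_assoc inv_solve_right)
    then show "inv x \<in> ?N"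
      using xc by auto
  next
    show "\<one> \<in> ?N"
      by (auto intro!: bexI[of _ \<one>])
  qed auto
  moreover have "S \<subseteq> ?N"
  proof
    fix s assume s: "s \<in> S"
    have "\<phi> (g \<otimes> s) = \<phi> g \<otimes> \<pi> s [^] dir s \<one>" if g: "g \<in> carrier G" for g
    proof (cases "\<pi> s \<otimes> \<pi> s = \<one>")
      case True
      then have "inv (\<pi> s) = \<pi> s"
        using s by (intro inv_equality) simp_all
      then have "\<pi> s [^] dir s x = \<pi> s" for x
        using dir_cases[of s x] s int_pow_neg[of "\<pi> s" 1] by auto
      then show ?thesis
        using \<phi>_mult[OF g s] by simp
    next
      case False
      then show ?thesis
        using \<phi>_mult[OF g s] const[OF s _ g] by simp
    qed
    then show "s \<in> ?N"
      using s by auto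
  qed
  ultimately have N: "carrier G \<subseteq> ?N"
    by (rule connection_set_generates[OF S])
  have \<phi>_mult: "\<phi> (g \<otimes> x) = \<phi> g \<otimes> (\<phi> x \<otimes> inv (\<phi> \<one>))" if "g \<in> carrier G" "x \<in> carrier G" for g x
  proof -
    have "x \<in> ?N"
      using N that(2) by (rule subsetD)
    then obtain c where c: "c \<in> carrier G" "\<And>g. g \<in> carrier G \<Longrightarrow> \<phi> (g \<otimes> x) = \<phi> g \<otimes> c"
      by blast
    have "\<phi> x \<otimes> inv (\<phi> \<one>) = c"
      using c(1) c(2)[OF one_closed] that by (simp add: m_ac)
    then show ?thesis
      using c that by simp
  qed
  let ?\<tau> = "\<lambda>x. \<phi> x \<otimes> inv (\<phi> \<one>)"
  have "bij_betw (\<lambda>x. x \<otimes> inv (\<phi> \<one>)) (carrier G) (carrier G)"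
    by (rule bij_betw_byWitness[of _ "\<lambda>x. x \<otimes> \<phi> \<one>"]) (auto simp: m_assoc)
  then have "bij_betw ?\<tau> (carrier G) (carrier G)"
    using bij_betw_trans[OF bij] by (simp add: o_def)
  moreover have "?\<tau> \<in> hom G G"
    by (rule homI) (simp_all add: \<phi>_mult m_ac)
  ultimately have "?\<tau> \<in> iso G G"
    by (simp add: iso_def)
  moreover have "\<phi> x = ?\<tau> x \<otimes> \<phi> \<one>" if "x \<in> carrier G" for x
    using that by (simp add: m_assoc)
  ultimately show ?thesis
    unfolding affine_bijection_def using bij
    by (intro conjI bexI[of _ ?\<tau>] bexI[of _ "\<phi> \<one>"] ballI) simp_all
qed

text \<open>If \<open>dir s\<close> is not constant, some colour u is not a period of it, because
  \<open>S\<close> generates the group; \<open>dir_change\<close> shows that (\<pi> u)^2 is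
  nontrivial too. What remains is to distinguish whether s or u is a short colour or both are
  long.\<close>

lemma nonsquare_four_two_of_not_affine:
  assumes "\<not> affine_bijection G \<phi>"
  shows "nonsquare_four_two G"
proof -
  obtain s x where s: "s \<in> S" "\<pi> s \<otimes> \<pi> s \<noteq> \<one>" and x: "x \<in> carrier G" "dir s x \<noteq> dir s \<one>"
    using affine_if_dir_constant assms by blast
  have "x \<notin> periods G (dir s)"
    using x periodsD[of x "dir s" \<one>] by auto
  then have "\<not> S \<subseteq> periods G (dir s)"
    using connection_set_generates[OF S subgroup_periods] x by blast
  then obtain u g where u: "u \<in> S" and g: "g \<in> carrier G" and ne: "dir s g \<noteq> dir s (g \<otimes> u)"
    by (force simp: periods_def)
  have "\<pi> u \<otimes> \<pi> u \<noteq> \<one>"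
    using dir_change(2)[OF g s(1) u ne s(2)] s by auto
  then show ?thesis
    using nonsquare_four_two_of_short_colour[of s] nonsquare_four_two_of_short_colour[of u]
      nonsquare_four_two_of_long_colours[OF g s(1) _ u _ ne] s u by blast
qed

end

section \<open>The equivalence of the four conditions\<close>

lemma (in comm_group) nonsquare_four_two_of_not_strongly_CCA:
  assumes "connection_set G S" "cayley_connected G S" "\<not> strongly_CCA G S"
  shows "nonsquare_four_two G"
proof -
  obtain \<phi> \<pi> where "cayley_automorphism G S \<phi>" "bij_betw \<pi> S S" "\<not> affine_bijection G \<phi>"
      "\<And>g s. \<lbrakk>g \<in> carrier G; s \<in> S\<rbrakk> \<Longrightarrow> \<phi> (g \<otimes> s) \<in> {\<phi> g \<otimes> \<pi> s, \<phi> g \<otimes> inv (\<pi> s)}"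
    using assms(3) unfolding strongly_CCA_def colour_permuting_def by blast
  then interpret colour_permutation G S \<phi> \<pi>
    using assms(1,2) by unfold_locales
  show ?thesis
    using \<open>\<not> affine_bijection G \<phi>\<close> by (rule nonsquare_four_two_of_not_affine)
qed

lemma (in comm_group) colour_preserving_imp_permuting:
  "colour_preserving G S \<phi> \<Longrightarrow> colour_permuting G S \<phi>"
  unfolding colour_preserving_def colour_permuting_def
  by (intro exI[of _ id]) auto

lemma (in comm_group) CCA_if_strongly_CCA: "strongly_CCA G S \<Longrightarrow> CCA G S"
  using colour_preserving_imp_permuting unfolding strongly_CCA_def CCA_def by blast

lemma (in comm_group) nonsquare_four_two_of_summand:
  assumes H: "subgroup H G"
    and iso: "G \<cong> G\<lparr>carrier := H\<rparr> \<times>\<times> (integer_mod_group 4 \<times>\<times> integer_mod_group 2) \<or>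
      G \<cong> G\<lparr>carrier := H\<rparr> \<times>\<times> (integer_mod_group 2 \<times>\<times> integer_mod_group 2) \<and> (\<exists>h\<in>H. ord h = 4)"
  shows "nonsquare_four_two G"
proof -
  interpret H: group "G\<lparr>carrier := H\<rparr>"
    by (rule subgroup.subgroup_is_group[OF H is_group])
  note grp = DirProd_group[OF H.is_group DirProd_group[OF group_integer_mod_group group_integer_mod_group]]
  show ?thesis
    using iso
  proof
    assume "G \<cong> G\<lparr>carrier := H\<rparr> \<times>\<times> (integer_mod_group 4 \<times>\<times> integer_mod_group 2)"
    then show ?thesis
      using group.nonsquare_four_two_iso[OF grp iso_sym is_group H.nonsquare_four_two_DirProd_4_2] by blast
  next
    assume *: "G \<cong> G\<lparr>carrier := H\<rparr> \<times>\<times> (integer_mod_group 2 \<times>\<times> integer_mod_group 2) \<and> (\<exists>h\<in>H. ord h = 4)"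
    then obtain h where h: "h \<in> H" "ord h = 4"
      by blast
    have hG: "h \<in> carrier G"
      using h H subgroup.subset by blast
    have "h [^] (2::nat) = h \<otimes> h" "h [^] (4::nat) = (h \<otimes> h) \<otimes> (h \<otimes> h)"
      using hG by (simp_all add: numeral_eq_Suc m_assoc)
    then have "h \<otimes> h \<noteq> \<one>" "(h \<otimes> h) \<otimes> (h \<otimes> h) = \<one>"
      using hG h pow_eq_id[OF hG, of 2] pow_eq_id[OF hG, of 4] by auto
    then have "nonsquare_four_two (G\<lparr>carrier := H\<rparr> \<times>\<times> (integer_mod_group 2 \<times>\<times> integer_mod_group 2))"
      using H.nonsquare_four_two_DirProd_2_2[of h] h by simp
    then show ?thesis
      using group.nonsquare_four_two_iso[OF grp iso_sym is_group] * by blast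
  qed
qed

lemma (in group) ord_square_of_ord_8:
  assumes "subgroup H G" "h \<in> H" "ord h = 8"
  shows "h \<otimes> h \<in> H" "ord (h \<otimes> h) = 4"
proof -
  show "h \<otimes> h \<in> H"
    using assms by (simp add: subgroup.m_closed)
  have "h \<in> carrier G"
    using assms subgroup.subset by blast
  moreover from this have "h [^] (2::nat) = h \<otimes> h"
    by (simp add: numeral_2_eq_2)
  ultimately show "ord (h \<otimes> h) = 4"
    using assms ord_pow[of h 2] by simp
qed

theorem corollary3p3:
  fixes G :: "('a, 'b) monoid_scheme"
  assumes "comm_group G"
  shows
    "((\<exists>S. connection_set G S \<and> cayley_connected G S \<and> \<not> CCA G S) \<longleftrightarrow>
      (\<exists>S. connection_set G S \<and> cayley_connected G S \<and> \<not> strongly_CCA G S)) \<and>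
     ((\<exists>S. connection_set G S \<and> cayley_connected G S \<and> \<not> strongly_CCA G S) \<longleftrightarrow>
      (\<exists>H. subgroup H G \<and>
        (G \<cong> G\<lparr>carrier := H\<rparr> \<times>\<times> (integer_mod_group 4 \<times>\<times> integer_mod_group 2) \<or>
         G \<cong> G\<lparr>carrier := H\<rparr> \<times>\<times> (integer_mod_group 2 \<times>\<times> integer_mod_group 2) \<and>
           (\<exists>h\<in>H. group.ord G h = 4)))) \<and>
     ((\<exists>H. subgroup H G \<and>
        (G \<cong> G\<lparr>carrier := H\<rparr> \<times>\<times> (integer_mod_group 4 \<times>\<times> integer_mod_group 2) \<or>
         G \<cong> G\<lparr>carrier := H\<rparr> \<times>\<times> (integer_mod_group 2 \<times>\<times> integer_mod_group 2) \<and>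
           (\<exists>h\<in>H. group.ord G h = 4))) \<longleftrightarrow>
      (\<exists>H. subgroup H G \<and>
        (G \<cong> G\<lparr>carrier := H\<rparr> \<times>\<times> (integer_mod_group 4 \<times>\<times> integer_mod_group 2) \<or>
         G \<cong> G\<lparr>carrier := H\<rparr> \<times>\<times> (integer_mod_group 2 \<times>\<times> integer_mod_group 2) \<and>
           (\<exists>h\<in>H. group.ord G h = 8))))"
    (is "(?P1 \<longleftrightarrow> ?P2) \<and> (?P2 \<longleftrightarrow> ?P3) \<and> (?P3 \<longleftrightarrow> ?P4)")
proof -
  interpret comm_group G by fact
  \<comment> \<open>The cycle passes through \<open>nonsquare_four_two\<close> twice: between the
    second and fourth conditions, and between the third and first.\<close>
  have "?P1 \<Longrightarrow> ?P2"
    using CCA_if_strongly_CCA by blast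
  moreover have "?P2 \<Longrightarrow> nonsquare_four_two G"
    using nonsquare_four_two_of_not_strongly_CCA by blast
  moreover have "nonsquare_four_two G \<Longrightarrow> ?P4"
    by (rule summand_of_nonsquare_four_two)
  moreover have "?P4 \<Longrightarrow> ?P3"
    using ord_square_of_ord_8 by meson
  moreover have "?P3 \<Longrightarrow> nonsquare_four_two G"
    using nonsquare_four_two_of_summand by blast
  moreover have "nonsquare_four_two G \<Longrightarrow> ?P1"
    by (rule not_CCA_of_nonsquare_four_two)
  ultimately show ?thesis
    by argo
qed

end
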